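(* For a number $p\in[1,\infty]$, the coordinatewise multiplication $\ell_p\times\ell_p\to\ell_p$, $(x,y)\mapsto xy$, preserves unconditional convergence if and only if $p\in[1,2]\cup\{\infty\}$.
   Context: All Banach spaces are over the field $\mathbb F$ of real or complex numbers, and $\omega=\{0,1,2,\dots\}$. For $p\in[1,\infty]$, $\ell_p$ is the Banach space of all sequences $x:\omega\to\mathbb F$ with $\|x\|_{\ell_p}<\infty$, where $\|x\|_{\ell_p}=\big(\sum_{n\in\omega}|x(n)|^p\big)^{1/p}$ if $p<\infty$ and $\|x\|_{\ell_\infty}=\sup_{n\in\omega}|x(n)|$. The coordinatewise product is $xy=(x(n)y(n))_{n\in\omega}$; it defines a continuous bilinear map $\ell_p\times\ell_p\to\ell_p$. A series $\sum_{n\in\omega}x_n$ in a Banach space $X$ converges unconditionally if for every permutation $\sigma$ of $\omega$ the series $\sum_{n\in\omega}x_{\sigma(n)}$ converges in $X$. A Banach action is a continuous bilinear function $A\times X\to Y$, $(a,x)\mapsto ax$, where $A,X,Y$ are Banach spaces. A Banach action $A\times X\to Y$ preserves unconditional convergence if for every unconditionally convergent series $\sum_{n\in\omega}x_n$ in $X$ and every bounded sequence $(a_n)_{n\in\omega}$ in $A$ the series $\sum_{n\in\omega}a_nx_n$ converges unconditionally in $Y$. *)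

theory Defs
  imports "HOL-Analysis.Analysis" "HOL-Library.Function_Algebras"
begin

section \<open>Banach spaces with an explicit carrier\<close>

text \<open>
  The exponent \<open>p\<close> of \<open>\<ell>\<^sub>p\<close> is a value, so the space cannot be a type of class \<^class>\<open>banach\<close>. A
  normed space is therefore given by a carrier inside a type of class \<^class>\<open>ab_group_add\<close>, together
  with a scalar multiplication and a norm, the last two being relevant only on the carrier.
\<close>

record ('k, 'v) normed_structure =
  carrier :: "'v set"
  scale :: "'k \<Rightarrow> 'v \<Rightarrow> 'v"
  vnorm :: "'v \<Rightarrow> real"

text \<open>
  The locale \<^locale>\<open>Metric_space\<close> wants nonnegativity and symmetry also off the carrier, hence the
  value 0 there.
\<close>

definition vdist :: "('k, 'v::ab_group_add) normed_structure \<Rightarrow> 'v \<Rightarrow> 'v \<Rightarrow> real" where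
  "vdist V x y = (if x \<in> carrier V \<and> y \<in> carrier V then vnorm V (x - y) else 0)"

definition norm_topology :: "('k, 'v::ab_group_add) normed_structure \<Rightarrow> 'v topology" where
  "norm_topology V = Metric_space.mtopology (carrier V) (vdist V)"

locale banach_space = vector_space "scale V"
  for V :: "('k::real_normed_field, 'v::ab_group_add) normed_structure" +
  assumes subspace_carrier: "subspace (carrier V)"
    and vnorm_nonneg: "x \<in> carrier V \<Longrightarrow> 0 \<le> vnorm V x"
    and vnorm_eq_0_iff: "x \<in> carrier V \<Longrightarrow> vnorm V x = 0 \<longleftrightarrow> x = 0"
    and vnorm_triangle: "x \<in> carrier V \<Longrightarrow> y \<in> carrier V \<Longrightarrow> vnorm V (x + y) \<le> vnorm V x + vnorm V y"
    and vnorm_scale: "x \<in> carrier V \<Longrightarrow> vnorm V (scale V c x) = norm c * vnorm V x"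
    and complete: "Metric_space.mcomplete (carrier V) (vdist V)"

definition banach_action ::
  "('k::real_normed_field, 'a::ab_group_add) normed_structure \<Rightarrow> ('k, 'x::ab_group_add) normed_structure
    \<Rightarrow> ('k, 'y::ab_group_add) normed_structure \<Rightarrow> ('a \<Rightarrow> 'x \<Rightarrow> 'y) \<Rightarrow> bool" where
  "banach_action A X Y act \<longleftrightarrow>
     banach_space A \<and> banach_space X \<and> banach_space Y \<and>
     (\<forall>a\<in>carrier A. \<forall>x\<in>carrier X. act a x \<in> carrier Y) \<and>
     (\<forall>a\<in>carrier A. \<forall>b\<in>carrier A. \<forall>x\<in>carrier X. act (a + b) x = act a x + act b x) \<and>
     (\<forall>a\<in>carrier A. \<forall>x\<in>carrier X. \<forall>y\<in>carrier X. act a (x + y) = act a x + act a y) \<and>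
     (\<forall>c. \<forall>a\<in>carrier A. \<forall>x\<in>carrier X. act (scale A c a) x = scale Y c (act a x)) \<and>
     (\<forall>c. \<forall>a\<in>carrier A. \<forall>x\<in>carrier X. act a (scale X c x) = scale Y c (act a x)) \<and>
     continuous_map (prod_topology (norm_topology A) (norm_topology X)) (norm_topology Y)
       (\<lambda>(a, x). act a x)"


section \<open>Unconditional convergence\<close>

definition series_converges ::
  "('k, 'v::ab_group_add) normed_structure \<Rightarrow> (nat \<Rightarrow> 'v) \<Rightarrow> bool" where
  "series_converges V x \<longleftrightarrow>
     range x \<subseteq> carrier V \<and> (\<exists>l. limitin (norm_topology V) (\<lambda>n. \<Sum>i<n. x i) l sequentially)"

definition converges_unconditionally ::
  "('k, 'v::ab_group_add) normed_structure \<Rightarrow> (nat \<Rightarrow> 'v) \<Rightarrow> bool" where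
  "converges_unconditionally V x \<longleftrightarrow> (\<forall>\<sigma>. bij \<sigma> \<longrightarrow> series_converges V (\<lambda>n. x (\<sigma> n)))"

definition bounded_sequence ::
  "('k, 'v::ab_group_add) normed_structure \<Rightarrow> (nat \<Rightarrow> 'v) \<Rightarrow> bool" where
  "bounded_sequence V a \<longleftrightarrow> range a \<subseteq> carrier V \<and> (\<exists>C. \<forall>n. vnorm V (a n) \<le> C)"

definition preserves_unconditional_convergence ::
  "('k, 'a::ab_group_add) normed_structure \<Rightarrow> ('k, 'x::ab_group_add) normed_structure
    \<Rightarrow> ('k, 'y::ab_group_add) normed_structure \<Rightarrow> ('a \<Rightarrow> 'x \<Rightarrow> 'y) \<Rightarrow> bool" where
  "preserves_unconditional_convergence A X Y act \<longleftrightarrow>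
     (\<forall>x a. converges_unconditionally X x \<longrightarrow> bounded_sequence A a
        \<longrightarrow> converges_unconditionally Y (\<lambda>n. act (a n) (x n)))"


section \<open>The spaces \<open>\<ell>\<^sub>p\<close>\<close>

text \<open>
  The norm of \<open>\<ell>\<^sub>p\<close> is taken real-valued; that it is finite is the condition \<open>lp_finite\<close>, outside of
  which the value of \<open>lp_norm\<close> has no meaning.
\<close>

definition lp_finite :: "ereal \<Rightarrow> (nat \<Rightarrow> 'k::real_normed_field) \<Rightarrow> bool" where
  "lp_finite p x \<longleftrightarrow>
     (if p = \<infinity> then bdd_above (range (\<lambda>n. norm (x n)))
      else summable (\<lambda>n. norm (x n) powr real_of_ereal p))"

definition lp_norm :: "ereal \<Rightarrow> (nat \<Rightarrow> 'k::real_normed_field) \<Rightarrow> real" where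
  "lp_norm p x =
     (if p = \<infinity> then (SUP n. norm (x n))
      else (\<Sum>n. norm (x n) powr real_of_ereal p) powr (1 / real_of_ereal p))"

definition lp :: "ereal \<Rightarrow> ('k::real_normed_field, nat \<Rightarrow> 'k) normed_structure" where
  "lp p = \<lparr>carrier = {x. lp_finite p x}, scale = (\<lambda>c x n. c * x n), vnorm = lp_norm p\<rparr>"

definition coordinatewise_mult :: "(nat \<Rightarrow> 'k::real_normed_field) \<Rightarrow> (nat \<Rightarrow> 'k) \<Rightarrow> nat \<Rightarrow> 'k" where
  "coordinatewise_mult x y = (\<lambda>n. x n * y n)"


section \<open>Coordinatewise multiplication is a Banach action\<close>

context banach_space
begin

lemma diff_carrier: "x \<in> carrier V \<Longrightarrow> y \<in> carrier V \<Longrightarrow> x - y \<in> carrier V"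
  using subspace_carrier subspace_diff by blast

lemma vdist_eq: "x \<in> carrier V \<Longrightarrow> y \<in> carrier V \<Longrightarrow> vdist V x y = vnorm V (x - y)"
  by (simp add: vdist_def)

lemma metric: "Metric_space (carrier V) (vdist V)"
proof
  fix x y
  show "0 \<le> vdist V x y"
    by (simp add: vdist_def vnorm_nonneg diff_carrier)
  show "vdist V x y = vdist V y x"
    using vnorm_scale[OF diff_carrier, of x y "-1"] by (simp add: vdist_def)
next
  fix x y assume "x \<in> carrier V" "y \<in> carrier V"
  then show "vdist V x y = 0 \<longleftrightarrow> x = y"
    by (simp add: vdist_def vnorm_eq_0_iff diff_carrier)
next
  fix x y z assume "x \<in> carrier V" "y \<in> carrier V" "z \<in> carrier V"
  then show "vdist V x z \<le> vdist V x y + vdist V y z"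
    using vnorm_triangle[of "x - y" "y - z"] by (simp add: vdist_def diff_carrier)
qed

end

lemma banach_actionI:
  assumes A: "banach_space A" and X: "banach_space X" and Y: "banach_space Y"
    and mem: "\<And>a x. a \<in> carrier A \<Longrightarrow> x \<in> carrier X \<Longrightarrow> act a x \<in> carrier Y"
    and add_left: "\<And>a b x. a \<in> carrier A \<Longrightarrow> b \<in> carrier A \<Longrightarrow> x \<in> carrier X
            \<Longrightarrow> act (a + b) x = act a x + act b x"
    and add_right: "\<And>a x y. a \<in> carrier A \<Longrightarrow> x \<in> carrier X \<Longrightarrow> y \<in> carrier X
            \<Longrightarrow> act a (x + y) = act a x + act a y"
    and scale_left: "\<And>c a x. a \<in> carrier A \<Longrightarrow> x \<in> carrier X
            \<Longrightarrow> act (scale A c a) x = scale Y c (act a x)"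
    and scale_right: "\<And>c a x. a \<in> carrier A \<Longrightarrow> x \<in> carrier X
            \<Longrightarrow> act a (scale X c x) = scale Y c (act a x)"
    and bound: "\<And>a x. a \<in> carrier A \<Longrightarrow> x \<in> carrier X
            \<Longrightarrow> vnorm Y (act a x) \<le> vnorm A a * vnorm X x"
  shows "banach_action A X Y act"
proof -
  interpret A: banach_space A by fact
  interpret X: banach_space X by fact
  interpret Y: banach_space Y by fact
  interpret MA: Metric_space "carrier A" "vdist A" by (rule A.metric)
  interpret MX: Metric_space "carrier X" "vdist X" by (rule X.metric)
  interpret MY: Metric_space "carrier Y" "vdist Y" by (rule Y.metric)
  have "continuous_map (prod_topology MA.mtopology MX.mtopology) MY.mtopology (\<lambda>(a, x). act a x)"
    unfolding MY.continuous_map_to_metric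
  proof (intro ballI allI impI)
    fix z and e :: real
    assume "z \<in> topspace (prod_topology MA.mtopology MX.mtopology)" and e: "0 < e"
    then obtain a x where z: "z = (a, x)" and a: "a \<in> carrier A" and x: "x \<in> carrier X"
      by auto
    define M where "M = vnorm A a + vnorm X x + 1"
    have M: "M > 0"
      using A.vnorm_nonneg[OF a] X.vnorm_nonneg[OF x] by (simp add: M_def)
    define d where "d = min 1 (e / (M + 1))"
    have d: "0 < d" "d \<le> 1" "d * M < e"
    proof -
      show "0 < d" "d \<le> 1" using e M by (auto simp: d_def)
      have "d * M \<le> (e / (M + 1)) * M"
        using M by (intro mult_right_mono) (auto simp: d_def)
      also have "\<dots> < e" using e M by (simp add: field_simps)
      finally show "d * M < e" .
    qed
    have close: "act b y \<in> MY.mball (act a x) e" if b: "b \<in> MA.mball a d" and y: "y \<in> MX.mball x d" for b y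
    proof -
      have bA: "b \<in> carrier A" and yX: "y \<in> carrier X" using b y by auto
      note cs = A.diff_carrier[OF a bA] X.diff_carrier[OF x yX]
      have b': "vnorm A (a - b) < d" using b a bA by (simp add: A.vdist_eq)
      have y': "vnorm X (x - y) < d" using y x yX by (simp add: X.vdist_eq)
      have y2: "vnorm X y \<le> vnorm X x + d"
        using MX.triangle[of y x 0] MX.commute[of y x] x yX y' X.subspace_0[OF X.subspace_carrier]
        by (simp add: X.vdist_eq)
      have "act a x - act b y = act a (x - y) + act (a - b) y"
        using add_right[OF a cs(2) yX] add_left[OF cs(1) bA yX] by simp
      then have "vnorm Y (act a x - act b y) \<le> vnorm Y (act a (x - y)) + vnorm Y (act (a - b) y)"
        by (simp add: Y.vnorm_triangle mem a cs yX)
      also have "\<dots> \<le> vnorm A a * vnorm X (x - y) + vnorm A (a - b) * vnorm X y"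
        by (intro add_mono bound a cs yX)
      also have "\<dots> \<le> vnorm A a * d + d * (vnorm X x + 1)"
        using b' y' y2 d A.vnorm_nonneg[OF a] X.vnorm_nonneg[OF yX]
        by (intro add_mono mult_mono) (auto simp: A.vnorm_nonneg X.vnorm_nonneg cs)
      also have "\<dots> = d * M" by (simp add: M_def algebra_simps)
      finally have "vnorm Y (act a x - act b y) < e" using d by simp
      then show ?thesis
        using a x bA yX by (simp add: mem Y.vdist_eq)
    qed
    show "\<exists>U. openin (prod_topology MA.mtopology MX.mtopology) U \<and> z \<in> U \<and>
            (\<forall>y\<in>U. (case y of (a, x) \<Rightarrow> act a x) \<in> MY.mball (case z of (a, x) \<Rightarrow> act a x) e)"
      using a x d close unfolding z
      by (intro exI[of _ "MA.mball a d \<times> MX.mball x d"]) (auto simp: openin_prod_Times_iff simp del: MY.in_mball)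
  qed
  then show ?thesis
    unfolding banach_action_def norm_topology_def using assms by blast
qed

lemma one_le_ereal_cases:
  fixes p :: ereal
  assumes "1 \<le> p"
  obtains (infinity) "p = \<infinity>" | (real) r where "p = ereal r" "1 \<le> r"
  using assms by (cases p) auto

text \<open>For \<open>p < \<infinity>\<close> the closed balls of \<open>\<ell>\<^sub>p\<close> are described by conditions on finitely many coordinates.\<close>

lemma lp_real_ball_iff:
  fixes x :: "nat \<Rightarrow> 'k::real_normed_field"
  assumes r: "1 \<le> r" and C: "0 \<le> C"
  shows "lp_finite (ereal r) x \<and> lp_norm (ereal r) x \<le> C \<longleftrightarrow>
           (\<forall>K. (\<Sum>n<K. norm (x n) powr r) \<le> C powr r)"
proof
  assume *: "lp_finite (ereal r) x \<and> lp_norm (ereal r) x \<le> C"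
  then have s: "summable (\<lambda>n. norm (x n) powr r)" by (simp add: lp_finite_def)
  let ?S = "\<Sum>n. norm (x n) powr r"
  have "0 \<le> ?S" using s by (intro suminf_nonneg) auto
  then have "?S = (?S powr (1/r)) powr r" using r by (simp add: powr_powr)
  also have "\<dots> \<le> C powr r"
    using * r by (intro powr_mono2) (auto simp: lp_norm_def)
  finally show "\<forall>K. (\<Sum>n<K. norm (x n) powr r) \<le> C powr r"
    using sum_le_suminf[OF s] by (meson finite_lessThan order_trans powr_ge_zero)
next
  assume *: "\<forall>K. (\<Sum>n<K. norm (x n) powr r) \<le> C powr r"
  have s: "summable (\<lambda>n. norm (x n) powr r)"
    by (rule summableI_nonneg_bounded[where x = "C powr r"]) (use * in auto)
  have "0 \<le> (\<Sum>n. norm (x n) powr r)" using s by (intro suminf_nonneg) auto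
  moreover have "(\<Sum>n. norm (x n) powr r) \<le> C powr r"
    using * s by (intro suminf_le_const) auto
  ultimately have "(\<Sum>n. norm (x n) powr r) powr (1/r) \<le> (C powr r) powr (1/r)"
    using r by (intro powr_mono2) auto
  then show "lp_finite (ereal r) x \<and> lp_norm (ereal r) x \<le> C"
    using s r C by (simp add: lp_finite_def lp_norm_def powr_powr)
qed

lemma lp_infinity_ball_iff:
  fixes x :: "nat \<Rightarrow> 'k::real_normed_field"
  shows "lp_finite \<infinity> x \<and> lp_norm \<infinity> x \<le> C \<longleftrightarrow> (\<forall>n. norm (x n) \<le> C)"
proof
  assume "lp_finite \<infinity> x \<and> lp_norm \<infinity> x \<le> C"
  then have bdd: "bdd_above (range (\<lambda>n. norm (x n)))" and C: "(SUP n. norm (x n)) \<le> C"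
    by (simp_all add: lp_finite_def lp_norm_def)
  show "\<forall>n. norm (x n) \<le> C"
    using order_trans[OF cSUP_upper[OF UNIV_I bdd] C] by blast
next
  assume "\<forall>n. norm (x n) \<le> C"
  then show "lp_finite \<infinity> x \<and> lp_norm \<infinity> x \<le> C"
    unfolding lp_finite_def lp_norm_def by (auto intro!: bdd_aboveI[of _ C] cSUP_least)
qed

lemma lp_norm_nonneg: "lp_finite p x \<Longrightarrow> 0 \<le> lp_norm p x"
  unfolding lp_finite_def lp_norm_def
  using order_trans[OF norm_ge_zero cSUP_upper[of 0 UNIV "\<lambda>n. norm (x n)"]] by auto

lemma norm_le_lp_norm:
  assumes "1 \<le> p" "lp_finite p x"
  shows "norm (x n) \<le> lp_norm p x"
  using assms(1)
proof (cases rule: one_le_ereal_cases)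
  case infinity
  then show ?thesis using assms lp_infinity_ball_iff[of x "lp_norm p x"] by simp
next
  case (real r)
  have nn: "0 \<le> lp_norm p x" using assms lp_norm_nonneg by blast
  have "norm (x n) powr r \<le> (\<Sum>n<Suc n. norm (x n) powr r)"
    by (simp add: sum_nonneg)
  also have "\<dots> \<le> lp_norm p x powr r"
    using lp_real_ball_iff[OF real(2) nn, of x] assms real by blast
  finally show ?thesis
    using powr_less_mono2[of r "lp_norm p x" "norm (x n)"] real nn by linarith
qed

lemma powr_convex_nonneg:
  fixes u v :: real
  assumes "1 \<le> r" "0 \<le> u" "0 \<le> v" "0 \<le> t" "t \<le> 1"
  shows "(t * u + (1 - t) * v) powr r \<le> t * u powr r + (1 - t) * v powr r"
proof -
  have le: "t powr r \<le> t" if "0 \<le> t" "t \<le> 1" for t :: real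
    using that assms(1) by (cases "t = 0") (auto intro: powr_le_one_le)
  consider "u = 0" | "v = 0" | "0 < u" "0 < v" using assms by fastforce
  then show ?thesis
  proof cases
    case 1
    then show ?thesis using mult_right_mono[OF le[of "1 - t"], of "v powr r"] assms by (simp add: powr_mult)
  next
    case 2
    then show ?thesis using mult_right_mono[OF le[of t], of "u powr r"] assms by (simp add: powr_mult)
  next
    case 3
    then show ?thesis
      using convex_onD[OF powr_convex[OF assms(1)], of "1 - t" u v] assms by simp
  qed
qed

lemma lp_real_minkowski:
  fixes x y :: "nat \<Rightarrow> 'k::real_normed_field"
  assumes r: "1 \<le> r" and x: "lp_finite (ereal r) x" "lp_norm (ereal r) x \<le> a"
    and y: "lp_finite (ereal r) y" "lp_norm (ereal r) y \<le> b" and ab: "0 < a" "0 < b"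
  shows "lp_finite (ereal r) (x + y) \<and> lp_norm (ereal r) (x + y) \<le> a + b"
proof -
  have xK: "(\<Sum>n<K. norm (x n) powr r) \<le> a powr r"
   and yK: "(\<Sum>n<K. norm (y n) powr r) \<le> b powr r" for K
    using lp_real_ball_iff[OF r, of a x] lp_real_ball_iff[OF r, of b y] x y ab by auto
  define t where "t = a / (a + b)"
  have t: "0 \<le> t" "t \<le> 1" using ab by (auto simp: t_def)
  have t': "1 - t = b / (a + b)" using ab by (simp add: t_def field_simps)
  have *: "norm ((x + y) n) powr r
      \<le> (a + b) powr r * (t * (norm (x n) powr r / a powr r) + (1 - t) * (norm (y n) powr r / b powr r))" for n
  proof -
    have "norm ((x + y) n) powr r \<le> (norm (x n) + norm (y n)) powr r"
      using r by (intro powr_mono2) (auto simp: norm_triangle_ineq)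
    also have "norm (x n) + norm (y n) = (a + b) * (t * (norm (x n) / a) + (1 - t) * (norm (y n) / b))"
      using ab unfolding t' by (simp add: t_def distrib_left)
    also have "\<dots> powr r = (a + b) powr r * (t * (norm (x n) / a) + (1 - t) * (norm (y n) / b)) powr r"
      by (rule powr_mult)
    also have "\<dots> \<le> (a + b) powr r * (t * (norm (x n) / a) powr r + (1 - t) * (norm (y n) / b) powr r)"
      using ab r t by (intro mult_left_mono powr_convex_nonneg) auto
    finally show ?thesis by (simp add: powr_divide)
  qed
  have "(\<Sum>n<K. norm ((x + y) n) powr r) \<le> (a + b) powr r" for K
  proof -
    have "(\<Sum>n<K. norm ((x + y) n) powr r)
        \<le> (\<Sum>n<K. (a + b) powr r * (t * (norm (x n) powr r / a powr r) + (1 - t) * (norm (y n) powr r / b powr r)))"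
      by (intro sum_mono *)
    also have "\<dots> = (a + b) powr r * (t * ((\<Sum>n<K. norm (x n) powr r) / a powr r)
                      + (1 - t) * ((\<Sum>n<K. norm (y n) powr r) / b powr r))"
      by (simp only: sum.distrib sum_divide_distrib flip: sum_distrib_left)
    also have "\<dots> \<le> (a + b) powr r * (t * 1 + (1 - t) * 1)"
      using xK[of K] yK[of K] ab t by (intro mult_left_mono add_mono) (auto simp: divide_simps)
    finally show ?thesis by simp
  qed
  then show ?thesis
    using lp_real_ball_iff[OF r, of "a + b" "x + y"] ab by auto
qed

lemma lp_triangle:
  fixes x y :: "nat \<Rightarrow> 'k::real_normed_field"
  assumes p: "1 \<le> p" and x: "lp_finite p x" and y: "lp_finite p y"
  shows "lp_finite p (x + y) \<and> lp_norm p (x + y) \<le> lp_norm p x + lp_norm p y"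
  using p
proof (cases rule: one_le_ereal_cases)
  case infinity
  then show ?thesis
    using lp_infinity_ball_iff[of "x + y" "lp_norm p x + lp_norm p y"]
      norm_le_lp_norm[OF p x] norm_le_lp_norm[OF p y]
    by (simp add: norm_triangle_mono)
next
  case (real r)
  have nn: "0 \<le> lp_norm p x" "0 \<le> lp_norm p y" using x y lp_norm_nonneg by blast+
  have *: "lp_finite p (x + y) \<and> lp_norm p (x + y) \<le> lp_norm p x + lp_norm p y + e" if "0 < e" for e
    using lp_real_minkowski[OF real(2), of x "lp_norm p x + e/2" y "lp_norm p y + e/2"] that x y nn real
    by auto
  then show ?thesis
    using *[of 1] field_le_epsilon by auto
qed

lemma lp_scale:
  fixes x :: "nat \<Rightarrow> 'k::real_normed_field"
  assumes p: "1 \<le> p" and x: "lp_finite p x"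
  shows "lp_finite p (\<lambda>n. c * x n) \<and> lp_norm p (\<lambda>n. c * x n) = norm c * lp_norm p x"
proof -
  have le: "lp_finite p (\<lambda>n. c * x n) \<and> lp_norm p (\<lambda>n. c * x n) \<le> norm c * lp_norm p x"
    if x: "lp_finite p x" for c :: 'k and x
    using p
  proof (cases rule: one_le_ereal_cases)
    case infinity
    then show ?thesis
      using lp_infinity_ball_iff[of "\<lambda>n. c * x n" "norm c * lp_norm p x"] norm_le_lp_norm[OF p x]
      by (simp add: norm_mult mult_left_mono)
  next
    case (real r)
    have nn: "0 \<le> lp_norm p x" using x lp_norm_nonneg by blast
    have "(\<Sum>n<K. norm (x n) powr r) \<le> lp_norm p x powr r" for K
      using lp_real_ball_iff[OF real(2) nn, of x] x real by blast
    then have "(\<Sum>n<K. norm (c * x n) powr r) \<le> (norm c * lp_norm p x) powr r" for K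
      by (simp add: norm_mult powr_mult mult_left_mono flip: sum_distrib_left)
    then show ?thesis
      using lp_real_ball_iff[OF real(2), of "norm c * lp_norm p x" "\<lambda>n. c * x n"] nn real by simp
  qed
  show ?thesis
  proof (cases "c = 0")
    case True
    then show ?thesis using le[OF x, of c] lp_norm_nonneg[of p "\<lambda>n. c * x n"] by auto
  next
    case False
    have "lp_norm p x \<le> norm (inverse c) * lp_norm p (\<lambda>n. c * x n)"
      using le[of "\<lambda>n. c * x n" "inverse c"] le[OF x, of c] False by (simp flip: mult.assoc)
    then have "norm c * lp_norm p x \<le> norm c * (norm (inverse c) * lp_norm p (\<lambda>n. c * x n))"
      by (intro mult_left_mono) auto
    also have "\<dots> = lp_norm p (\<lambda>n. c * x n)"
      using False by (simp add: norm_inverse)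
    finally show ?thesis using le[OF x, of c] by simp
  qed
qed

lemma lp_mult:
  fixes x y :: "nat \<Rightarrow> 'k::real_normed_field"
  assumes p: "1 \<le> p" and x: "lp_finite p x" and y: "lp_finite p y"
  shows "lp_finite p (\<lambda>n. x n * y n) \<and> lp_norm p (\<lambda>n. x n * y n) \<le> lp_norm p x * lp_norm p y"
proof -
  have nn: "0 \<le> lp_norm p x" "0 \<le> lp_norm p y" using x y lp_norm_nonneg by blast+
  note nx = norm_le_lp_norm[OF p x]
  show ?thesis
    using p
  proof (cases rule: one_le_ereal_cases)
    case infinity
    then show ?thesis
      using lp_infinity_ball_iff[of "\<lambda>n. x n * y n" "lp_norm p x * lp_norm p y"] nx
        norm_le_lp_norm[OF p y] nn
      by (simp add: norm_mult mult_mono)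
  next
    case (real r)
    have "(\<Sum>n<K. norm (x n * y n) powr r) \<le> (lp_norm p x * lp_norm p y) powr r" for K
    proof -
      have "(\<Sum>n<K. norm (x n * y n) powr r) \<le> (\<Sum>n<K. lp_norm p x powr r * norm (y n) powr r)"
        using nx real by (intro sum_mono) (simp add: norm_mult powr_mult mult_right_mono powr_mono2)
      also have "\<dots> \<le> lp_norm p x powr r * lp_norm p y powr r"
        using lp_real_ball_iff[OF real(2) nn(2), of y] y real
        by (simp add: mult_left_mono flip: sum_distrib_left)
      finally show ?thesis by (simp add: powr_mult)
    qed
    then show ?thesis
      using lp_real_ball_iff[OF real(2), of "lp_norm p x * lp_norm p y" "\<lambda>n. x n * y n"] nn real by simp
  qed
qed

lemma lp_ball_closed:
  fixes x :: "nat \<Rightarrow> nat \<Rightarrow> 'k::real_normed_field"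
  assumes p: "1 \<le> p" and C: "0 \<le> C"
    and ev: "\<forall>\<^sub>F m in sequentially. lp_finite p (x m) \<and> lp_norm p (x m) \<le> C"
    and lim: "\<And>k. (\<lambda>m. x m k) \<longlonglongrightarrow> l k"
  shows "lp_finite p l \<and> lp_norm p l \<le> C"
  using p
proof (cases rule: one_le_ereal_cases)
  case infinity
  have "norm (l k) \<le> C" for k
    using ev unfolding infinity lp_infinity_ball_iff
    by (intro tendsto_upperbound[OF tendsto_norm[OF lim]]) (auto elim: eventually_mono)
  then show ?thesis by (simp add: infinity lp_infinity_ball_iff)
next
  case (real r)
  have "(\<Sum>k<K. norm (l k) powr r) \<le> C powr r" for K
  proof (rule tendsto_upperbound)
    show "(\<lambda>m. \<Sum>k<K. norm (x m k) powr r) \<longlonglongrightarrow> (\<Sum>k<K. norm (l k) powr r)"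
      using real by (intro tendsto_sum tendsto_powr' tendsto_norm lim tendsto_const) auto
    show "\<forall>\<^sub>F m in sequentially. (\<Sum>k<K. norm (x m k) powr r) \<le> C powr r"
      using ev unfolding real lp_real_ball_iff[OF real(2) C] by (auto elim: eventually_mono)
  qed simp
  then show ?thesis using lp_real_ball_iff[OF real(2) C] real by blast
qed

lemma banach_space_lp:
  assumes p: "1 \<le> p"
  shows "banach_space (lp p :: ('k::{real_normed_field, banach}, nat \<Rightarrow> 'k) normed_structure)"
proof -
  let ?V = "lp p :: ('k, nat \<Rightarrow> 'k) normed_structure"
  have vs: "vector_space (scale ?V)"
    by unfold_locales (auto simp: lp_def fun_eq_iff algebra_simps)
  interpret vector_space "scale ?V" by (rule vs)
  have zero: "lp_finite p (0 :: nat \<Rightarrow> 'k)"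
    by (auto simp: lp_finite_def)
  have sub: "subspace (carrier ?V)"
    unfolding subspace_def using zero lp_triangle[OF p] lp_scale[OF p] by (auto simp: lp_def)
  have diff: "lp_finite p (x - y)" if "lp_finite p x" "lp_finite p y" for x y :: "nat \<Rightarrow> 'k"
    using subspace_diff[OF sub, of x y] that by (simp add: lp_def)
  have eq0: "lp_norm p x = 0 \<longleftrightarrow> x = 0" if "lp_finite p x" for x :: "nat \<Rightarrow> 'k"
  proof
    assume "lp_norm p x = 0"
    then show "x = 0" using norm_le_lp_norm[OF p that] by (auto simp: fun_eq_iff)
  next
    assume "x = 0"
    then show "lp_norm p x = 0" using lp_scale[OF p that, of 0] by (simp add: zero_fun_def)
  qed
  have sym: "lp_norm p (x - y) = lp_norm p (y - x)" if "lp_finite p x" "lp_finite p y" for x y :: "nat \<Rightarrow> 'k"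
    using lp_scale[OF p diff[OF that], of "-1"] by (simp add: fun_diff_def)
  have tri: "lp_norm p (x - z) \<le> lp_norm p (x - y) + lp_norm p (y - z)"
    if "lp_finite p x" "lp_finite p y" "lp_finite p z" for x y z :: "nat \<Rightarrow> 'k"
    using lp_triangle[OF p diff[OF that(1,2)] diff[OF that(2,3)]] by simp
  interpret M: Metric_space "carrier ?V" "vdist ?V"
    by unfold_locales (auto simp: vdist_def lp_def diff lp_norm_nonneg eq0 sym intro: tri)
  have "M.mcomplete"
    unfolding M.mcomplete_def
  proof (intro allI impI)
    fix s assume s': "M.MCauchy s"
    have s: "lp_finite p (s n)" for n
      using s' unfolding M.MCauchy_def by (auto simp: lp_def)
    have dist: "vdist ?V (s m) (s n) = lp_norm p (s m - s n)" for m n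
      using s by (simp add: vdist_def lp_def)
    have Cauchy: "\<exists>N. \<forall>n n'. N \<le> n \<longrightarrow> N \<le> n' \<longrightarrow> lp_norm p (s n - s n') < e" if "0 < e" for e :: real
      using s' that unfolding M.MCauchy_def dist by blast
    have "Cauchy (\<lambda>n. s n k)" for k
    proof (rule CauchyI)
      fix e :: real assume "0 < e"
      then obtain N where N: "\<And>n n'. N \<le> n \<Longrightarrow> N \<le> n' \<Longrightarrow> lp_norm p (s n - s n') < e"
        using Cauchy by metis
      have "norm (s m k - s n k) < e" if "N \<le> m" "N \<le> n" for m n
        using norm_le_lp_norm[OF p diff[OF s s], of m n k] N[OF that] by simp
      then show "\<exists>M. \<forall>m\<ge>M. \<forall>n\<ge>M. norm (s m k - s n k) < e" by blast
    qed
    then obtain l where l: "\<And>k. (\<lambda>n. s n k) \<longlonglongrightarrow> l k"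
      unfolding Cauchy_convergent_iff convergent_def by metis
    have near: "\<exists>N. \<forall>n\<ge>N. lp_finite p (s n - l) \<and> lp_norm p (s n - l) \<le> e" if "0 < e" for e
    proof -
      from Cauchy[OF that] obtain N where
        N: "\<And>n n'. N \<le> n \<Longrightarrow> N \<le> n' \<Longrightarrow> lp_norm p (s n - s n') < e" by metis
      have "lp_finite p (s n - l) \<and> lp_norm p (s n - l) \<le> e" if "N \<le> n" for n
      proof (rule lp_ball_closed[OF p, where x = "\<lambda>m. s n - s m"])
        show "\<forall>\<^sub>F m in sequentially. lp_finite p (s n - s m) \<and> lp_norm p (s n - s m) \<le> e"
          using N[OF that] by (intro eventually_sequentiallyI[of N]) (auto simp: diff s less_imp_le)
        show "(\<lambda>m. (s n - s m) k) \<longlonglongrightarrow> (s n - l) k" for k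
          using tendsto_diff[OF tendsto_const l, of "s n k" k] by simp
      qed (use \<open>0 < e\<close> in simp)
      then show ?thesis by blast
    qed
    obtain N where "lp_finite p (s N - l)" using near[of 1] by auto
    then have lf: "lp_finite p l" using diff[OF s, of "s N - l" N] by simp
    have "limitin M.mtopology s l sequentially"
      unfolding M.limit_metric_sequentially
    proof (intro conjI allI impI)
      show "l \<in> carrier ?V" using lf by (simp add: lp_def)
      fix e :: real assume "0 < e"
      then obtain N where "\<forall>n\<ge>N. lp_norm p (s n - l) \<le> e / 2" using near[of "e/2"] by auto
      then show "\<exists>N. \<forall>n\<ge>N. s n \<in> carrier ?V \<and> vdist ?V (s n) l < e"
        using \<open>0 < e\<close> s lf by (intro exI[of _ N]) (force simp: vdist_def lp_def)
    qed
    then show "\<exists>x. limitin M.mtopology s x sequentially" by blast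
  qed
  then show ?thesis
    using vs sub lp_norm_nonneg eq0 lp_triangle[OF p, THEN conjunct2] lp_scale[OF p, THEN conjunct2]
    by (intro banach_space.intro banach_space_axioms.intro) (auto simp: lp_def)
qed

theorem banach_action_coordinatewise_mult:
  assumes "1 \<le> p"
  shows "banach_action (lp p) (lp p) (lp p)
    (coordinatewise_mult :: (nat \<Rightarrow> 'k::{real_normed_field, banach}) \<Rightarrow> _)"
  using banach_space_lp[OF assms] lp_mult[OF assms, THEN conjunct1] lp_mult[OF assms, THEN conjunct2]
  by (intro banach_actionI) (auto simp: lp_def coordinatewise_mult_def fun_eq_iff algebra_simps)

end

theory Submission
  imports Defs
begin

text \<open>
  Unconditional convergence is an unordered Cauchy criterion, so preservation amounts to an
  inequality for finite families: if all subset sums of \<open>x\<close> have norm at most \<open>e\<close> and all \<open>a n\<close> have norm at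
  most \<open>C\<close>, then \<open>\<Sum>n. a n * x n\<close> has norm at most a constant times \<open>C * e\<close>
  (\<open>preserves_unconditional_convergenceI\<close>, \<open>preserves_unconditional_convergenceD\<close>).

  For \<open>p = \<infinity>\<close> this holds because bounded subset sums of scalars bound the sum of their absolute
  values, coordinate by coordinate.

  For \<open>p \<le> 2\<close> one argues by duality. Let \<open>\<beta>\<close> be a nonnegative sequence in the unit ball of the dual space. Then
  the series \<open>\<beta> x n\<close> is unconditionally bounded in \<open>\<ell>\<^sub>1\<close>, and Khinchine's inequality (which shows that the
  inclusion of \<open>\<ell>\<^sub>1\<close> into \<open>\<ell>\<^sub>2\<close> is absolutely summing) bounds \<open>\<Sum>n. \<parallel>\<beta> x n\<parallel>\<^sub>2\<close>. Since
  \<open>\<parallel>a n\<parallel>\<^sub>2 \<le> \<parallel>a n\<parallel>\<^sub>p \<le> C\<close>, Cauchy--Schwarz bounds \<open>\<Sum>k. \<beta> k * (\<Sum>n. \<bar>a n k * x n k\<bar>)\<close>. The supremum over \<open>\<beta>\<close>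
  is replaced by the extremal choice of \<open>\<beta>\<close>, see \<open>sum_powr_multiplier_le\<close>.

  For \<open>2 < p < \<infinity>\<close> the finite inequality fails by a power of the logarithm of the dimension. On
  \<open>2\<^sup>L\<close> coordinates take, for each scale \<open>j < L\<close>, the rows of a block diagonal matrix of Walsh blocks of
  size \<open>2\<^sup>j\<close>.
  Multiplied by themselves and suitably normalised, the rows of each scale contribute the same constant
  vector, so the products add up linearly in \<open>L\<close>. For subset sums, by contrast, the scales do not add up:
  at scale \<open>j\<close> they are bounded by \<open>2 powr (j / p)\<close>, so that only large scales matter where the total is
  large, and there the energy is small by orthogonality. This limits the \<open>p\<close>-th power of the norm,
  divided by the number of coordinates, to order \<open>L\<^sup>2\<close> instead of \<open>L powr p\<close>
  (\<open>sum_powr_le_geometric\<close>, \<open>sum_powr_walsh_levels\<close>).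
\<close>

section \<open>Unconditional convergence as an unordered Cauchy criterion\<close>

lemma ex_bij_block:
  fixes B :: "nat set"
  assumes "B \<subseteq> {a..<b}"
  obtains h where "bij_betw h {a..<b} {a..<b}" "h ` {a..<a + card B} = B"
proof -
  have fin: "finite B" using assms finite_subset by blast
  have "card B \<le> b - a" using card_mono[OF _ assms] by simp
  show ?thesis
  proof (cases "B = {}")
    case True then show ?thesis using that[of id] by auto
  next
    case False
    then have ab: "a < b" using assms by fastforce
    with \<open>card B \<le> b - a\<close> have split: "{a..<b} = {a..<a + card B} \<union> {a + card B..<b}" by auto
    obtain f where f: "bij_betw f {a..<a + card B} B"
      using fin finite_same_card_bij[of "{a..<a + card B}" B] by auto
    have "card ({a..<b} - B) = b - (a + card B)"
      using card_Diff_subset[OF fin assms] by simp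
    then obtain g where g: "bij_betw g {a + card B..<b} ({a..<b} - B)"
      using finite_same_card_bij[of "{a + card B..<b}" "{a..<b} - B"] by auto
    define h where "h n = (if n < a + card B then f n else g n)" for n
    have hf: "bij_betw h {a..<a + card B} B"
      using f by (subst bij_betw_cong[of _ h f]) (auto simp: h_def)
    moreover have "bij_betw h {a + card B..<b} ({a..<b} - B)"
      using g by (subst bij_betw_cong[of _ h g]) (auto simp: h_def)
    ultimately have "bij_betw h ({a..<a + card B} \<union> {a + card B..<b}) (B \<union> ({a..<b} - B))"
      by (intro bij_betw_combine) auto
    then have "bij_betw h {a..<b} {a..<b}"
      using split assms by (simp add: Un_absorb1)
    then show ?thesis using that hf by (simp add: bij_betw_def)
  qed
qed

text \<open>
  Consecutive blocks \<open>{m j..<m (Suc j)}\<close> can be permuted independently of one another, so a permutation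
  can make any prescribed subset of each block contiguous.
\<close>

lemma ex_bij_blocks:
  fixes m :: "nat \<Rightarrow> nat"
  assumes m: "strict_mono m" "m 0 = 0" and F: "\<And>j. F j \<subseteq> {m j..<m (Suc j)}"
  obtains \<sigma> where "bij \<sigma>" "\<And>j. \<sigma> ` {m j..<m j + card (F j)} = F j"
proof -
  have "\<exists>h. bij_betw h {m j..<m (Suc j)} {m j..<m (Suc j)} \<and> h ` {m j..<m j + card (F j)} = F j" for j
    using ex_bij_block[OF F] by metis
  then obtain h where h: "\<And>j. bij_betw (h j) {m j..<m (Suc j)} {m j..<m (Suc j)}"
    "\<And>j. h j ` {m j..<m j + card (F j)} = F j" by metis
  define J where "J n = (LEAST j. n < m (Suc j))" for n
  have J: "J n = j" if "n \<in> {m j..<m (Suc j)}" for n j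
    unfolding J_def
  proof (rule Least_equality)
    show "n < m (Suc j)" using that by simp
    fix i assume "n < m (Suc i)"
    then have "m j < m (Suc i)" using that by simp
    then show "j \<le> i" using strict_mono_less[OF m(1)] by simp
  qed
  have ex: "\<exists>j. n \<in> {m j..<m (Suc j)}" for n
  proof -
    have "n < m (Suc n)" using strict_mono_imp_increasing[OF m(1), of "Suc n"] by simp
    then have "n < m (Suc (J n))" unfolding J_def by (rule LeastI)
    moreover have "m (J n) \<le> n"
    proof (cases "J n")
      case (Suc i)
      then have "\<not> n < m (Suc i)" using not_less_Least[of i "\<lambda>j. n < m (Suc j)"] by (simp add: J_def)
      then show ?thesis using Suc by simp
    qed (use m in simp)
    ultimately show ?thesis by auto
  qed
  have disj: "disjoint_family (\<lambda>j. {m j..<m (Suc j)})"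
    unfolding disjoint_family_on_def using J by blast
  define \<sigma> where "\<sigma> n = h (J n) n" for n
  have eq: "\<sigma> n = h j n" if "n \<in> {m j..<m (Suc j)}" for n j
    using J[OF that] by (simp add: \<sigma>_def)
  have "bij_betw \<sigma> (\<Union>j. {m j..<m (Suc j)}) (\<Union>j. {m j..<m (Suc j)})"
  proof (rule bij_betw_UNION_disjoint[OF disj])
    show "bij_betw \<sigma> {m j..<m (Suc j)} {m j..<m (Suc j)}" for j
      using h(1)[of j] eq by (subst bij_betw_cong[of _ \<sigma> "h j"]) auto
  qed
  moreover have "(\<Union>j. {m j..<m (Suc j)}) = UNIV" using ex by auto
  ultimately have "bij \<sigma>" by simp
  moreover have "\<sigma> ` {m j..<m j + card (F j)} = F j" for j
  proof -
    have "card (F j) \<le> m (Suc j) - m j" using card_mono[OF _ F[of j]] by simp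
    moreover have "m j < m (Suc j)" using m(1) by (simp add: strict_mono_Suc_iff)
    ultimately have "\<sigma> ` {m j..<m j + card (F j)} = h j ` {m j..<m j + card (F j)}"
      by (intro image_cong refl eq) auto
    then show ?thesis using h by simp
  qed
  ultimately show ?thesis using that by blast
qed

context banach_space
begin

lemma sum_carrier: "(\<And>i. i \<in> F \<Longrightarrow> x i \<in> carrier V) \<Longrightarrow> sum x F \<in> carrier V"
  using subspace_sum[OF subspace_carrier] by blast

lemma vnorm_zero: "vnorm V 0 = 0"
  using vnorm_eq_0_iff[of 0] subspace_0[OF subspace_carrier] by simp

lemma vnorm_sum:
  assumes "\<And>i. i \<in> F \<Longrightarrow> x i \<in> carrier V"
  shows "vnorm V (sum x F) \<le> (\<Sum>i\<in>F. vnorm V (x i))"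
  using assms
proof (induction F rule: infinite_finite_induct)
  case (insert i F)
  then have "vnorm V (x i + sum x F) \<le> vnorm V (x i) + vnorm V (sum x F)"
    by (intro vnorm_triangle sum_carrier) auto
  then show ?case using insert by simp
qed (simp_all add: vnorm_zero)

lemma series_converges_iff_Cauchy:
  "series_converges V x \<longleftrightarrow> range x \<subseteq> carrier V \<and>
     (\<forall>e>0. \<exists>N. \<forall>m n. N \<le> m \<longrightarrow> m \<le> n \<longrightarrow> vnorm V (sum x {m..<n}) < e)"
proof (cases "range x \<subseteq> carrier V")
  case True
  interpret M: Metric_space "carrier V" "vdist V" by (rule metric)
  let ?s = "\<lambda>n. \<Sum>i<n. x i"
  have mem: "sum x F \<in> carrier V" for F using True by (intro sum_carrier) auto
  have dist: "vdist V (?s n) (?s m) = vnorm V (sum x {m..<n})" if "m \<le> n" for m n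
    using sum_diff[of "{..<n}" "{..<m}" x] that
    by (simp add: vdist_eq mem lessThan_minus_lessThan)
  have "(\<exists>l. limitin M.mtopology ?s l sequentially) \<longleftrightarrow> M.MCauchy ?s"
    using M.convergent_imp_MCauchy[of ?s] complete mem unfolding M.mcomplete_def by blast
  also have "\<dots> \<longleftrightarrow> (\<forall>e>0. \<exists>N. \<forall>m n. N \<le> m \<longrightarrow> m \<le> n \<longrightarrow> vnorm V (sum x {m..<n}) < e)"
    (is "_ \<longleftrightarrow> (\<forall>e>0. ?C e)")
  proof -
    have "(\<exists>N. \<forall>n n'. N \<le> n \<longrightarrow> N \<le> n' \<longrightarrow> vdist V (?s n) (?s n') < e) \<longleftrightarrow> ?C e" for e
    proof (intro ex_cong1 iffI allI impI)
      fix N m n assume "\<forall>n n'. N \<le> n \<longrightarrow> N \<le> n' \<longrightarrow> vdist V (?s n) (?s n') < e" "N \<le> m" "m \<le> n"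
      then show "vnorm V (sum x {m..<n}) < e" using dist[of m n] by (metis le_trans)
    next
      fix N m n assume C: "\<forall>m n. N \<le> m \<longrightarrow> m \<le> n \<longrightarrow> vnorm V (sum x {m..<n}) < e" and *: "N \<le> m" "N \<le> n"
      show "vdist V (?s m) (?s n) < e"
        using dist[of m n] dist[of n m] C * M.commute[of "?s m" "?s n"] by (cases "m \<le> n") auto
    qed
    then show ?thesis using mem unfolding M.MCauchy_def by auto
  qed
  finally show ?thesis using True by (simp add: series_converges_def norm_topology_def)
qed (simp add: series_converges_def)

text \<open>
  If arbitrarily late finite sets with sums of norm at least \<open>e\<close> exist, then infinitely many of them
  can be chosen in successive blocks, and the permutation that makes each of them contiguous breaks the
  Cauchy criterion. This replaces the quantification over permutations by one over finite sets, which
  is what inequalities can be applied to.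
\<close>

theorem converges_unconditionally_iff_unordered_Cauchy:
  "converges_unconditionally V x \<longleftrightarrow> range x \<subseteq> carrier V \<and>
     (\<forall>e>0. \<exists>N. \<forall>F. finite F \<longrightarrow> F \<subseteq> {N..} \<longrightarrow> vnorm V (sum x F) < e)"
proof (intro iffI conjI allI impI)
  assume conv: "converges_unconditionally V x"
  then have "series_converges V (\<lambda>n. x (id n))" unfolding converges_unconditionally_def by blast
  then show "range x \<subseteq> carrier V" by (simp add: series_converges_def)
  fix e :: real assume e: "0 < e"
  show "\<exists>N. \<forall>F. finite F \<longrightarrow> F \<subseteq> {N..} \<longrightarrow> vnorm V (sum x F) < e"
  proof (rule ccontr)
    assume "\<not> ?thesis"
    then obtain F where F: "\<And>N. finite (F N)" "\<And>N. F N \<subseteq> {N..}" "\<And>N. e \<le> vnorm V (sum x (F N))"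
      by (metis linorder_not_less)
    define m where "m = rec_nat 0 (\<lambda>_ N. Suc (Max (insert N (F N))))"
    have m: "m 0 = 0" "m (Suc j) = Suc (Max (insert (m j) (F (m j))))" for j
      by (simp_all add: m_def)
    have "strict_mono m"
      unfolding strict_mono_Suc_iff m(2) using F(1) by (simp add: less_Suc_eq_le)
    moreover have "F (m j) \<subseteq> {m j..<m (Suc j)}" for j
      using F(1,2)[of "m j"] unfolding m(2) by (auto simp: less_Suc_eq_le)
    ultimately obtain \<sigma> where \<sigma>: "bij \<sigma>" "\<And>j. \<sigma> ` {m j..<m j + card (F (m j))} = F (m j)"
      using ex_bij_blocks[of m "\<lambda>j. F (m j)"] m(1) by metis
    obtain N where N: "\<And>k n. N \<le> k \<Longrightarrow> k \<le> n \<Longrightarrow> vnorm V (\<Sum>i=k..<n. x (\<sigma> i)) < e"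
      using conv \<sigma>(1) e unfolding converges_unconditionally_def series_converges_iff_Cauchy by meson
    have "N \<le> m N" using \<open>strict_mono m\<close> by (rule strict_mono_imp_increasing)
    then have "vnorm V (\<Sum>i=m N..<m N + card (F (m N)). x (\<sigma> i)) < e" by (rule N) simp
    also have "(\<Sum>i=m N..<m N + card (F (m N)). x (\<sigma> i)) = sum x (F (m N))"
      using sum.reindex[of \<sigma> "{m N..<m N + card (F (m N))}" x] \<sigma>
      by (simp add: inj_on_subset[OF bij_is_inj])
    finally show False using F(3)[of "m N"] by simp
  qed
next
  assume *: "range x \<subseteq> carrier V \<and>
     (\<forall>e>0. \<exists>N. \<forall>F. finite F \<longrightarrow> F \<subseteq> {N..} \<longrightarrow> vnorm V (sum x F) < e)"
  show "converges_unconditionally V x"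
    unfolding converges_unconditionally_def series_converges_iff_Cauchy
  proof (intro allI impI conjI)
    fix \<sigma> :: "nat \<Rightarrow> nat" assume \<sigma>: "bij \<sigma>"
    show "range (\<lambda>n. x (\<sigma> n)) \<subseteq> carrier V" using * by auto
    fix e :: real assume "0 < e"
    then obtain N where N: "\<And>F. finite F \<Longrightarrow> F \<subseteq> {N..} \<Longrightarrow> vnorm V (sum x F) < e" using * by meson
    have "finite (\<sigma> -` {..<N})" using \<sigma> by (intro finite_vimageI) (auto simp: bij_def)
    then obtain M where M: "\<And>i. i \<in> \<sigma> -` {..<N} \<Longrightarrow> i < M"
      by (metis finite_nat_set_iff_bounded)
    have "vnorm V (\<Sum>i=m..<n. x (\<sigma> i)) < e" if "M \<le> m" for m n
    proof -
      have "(\<Sum>i=m..<n. x (\<sigma> i)) = sum x (\<sigma> ` {m..<n})"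
        using \<sigma> by (subst sum.reindex) (auto intro: inj_on_subset simp: bij_def)
      moreover have "N \<le> \<sigma> i" if "m \<le> i" for i
        using M[of i] that \<open>M \<le> m\<close> by (cases "\<sigma> i < N") auto
      then have "\<sigma> ` {m..<n} \<subseteq> {N..}" by auto
      ultimately show ?thesis using N by simp
    qed
    then show "\<exists>M. \<forall>m n. M \<le> m \<longrightarrow> m \<le> n \<longrightarrow> vnorm V (\<Sum>i=m..<n. x (\<sigma> i)) < e" by blast
  qed
qed

end

section \<open>Preservation of unconditional convergence as a finite inequality\<close>

text \<open>
  A finite inequality that is homogeneous in both arguments transports the unordered Cauchy criterion
  from \<open>x\<close> to the products.
\<close>

lemma preserves_unconditional_convergenceI:
  assumes action: "banach_action A X Y act"
    and bound: "\<And>(F :: nat set) x a C e. finite F \<Longrightarrow> (\<And>n. n \<in> F \<Longrightarrow> x n \<in> carrier X) \<Longrightarrow>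
      (\<And>n. n \<in> F \<Longrightarrow> a n \<in> carrier A) \<Longrightarrow> 0 < C \<Longrightarrow> 0 < e \<Longrightarrow> (\<And>n. n \<in> F \<Longrightarrow> vnorm A (a n) \<le> C) \<Longrightarrow>
      (\<And>G. G \<subseteq> F \<Longrightarrow> vnorm X (sum x G) \<le> e) \<Longrightarrow>
      vnorm Y (\<Sum>n\<in>F. act (a n) (x n)) \<le> K * C * e"
  shows "preserves_unconditional_convergence A X Y act"
  unfolding preserves_unconditional_convergence_def
proof (intro allI impI)
  interpret A: banach_space A using action by (simp add: banach_action_def)
  interpret X: banach_space X using action by (simp add: banach_action_def)
  interpret Y: banach_space Y using action by (simp add: banach_action_def)
  fix x a assume "converges_unconditionally X x" and "bounded_sequence A a"
  then obtain C' where x: "\<And>n. x n \<in> carrier X" and a': "\<And>n. a n \<in> carrier A" "\<And>n. vnorm A (a n) \<le> C'"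
    and Cauchy: "\<And>e. 0 < e \<Longrightarrow> \<exists>N. \<forall>F. finite F \<longrightarrow> F \<subseteq> {N..} \<longrightarrow> vnorm X (sum x F) < e"
    unfolding X.converges_unconditionally_iff_unordered_Cauchy bounded_sequence_def by blast
  define C where "C = \<bar>C'\<bar> + 1"
  have C: "0 < C" by (simp add: C_def)
  have a: "a n \<in> carrier A" "vnorm A (a n) \<le> C" for n using a'[of n] by (auto simp: C_def)
  show "converges_unconditionally Y (\<lambda>n. act (a n) (x n))"
    unfolding Y.converges_unconditionally_iff_unordered_Cauchy
  proof (intro conjI allI impI)
    show "range (\<lambda>n. act (a n) (x n)) \<subseteq> carrier Y" using action x a by (auto simp: banach_action_def)
    fix e :: real assume e: "0 < e"
    have KC: "0 \<le> \<bar>K\<bar> * C" using C by simp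
    define d where "d = e / (\<bar>K\<bar> * C + 1)"
    have d: "0 < d" using e KC unfolding d_def by (intro divide_pos_pos) auto
    obtain N where N: "\<And>F. finite F \<Longrightarrow> F \<subseteq> {N..} \<Longrightarrow> vnorm X (sum x F) < d" using Cauchy[OF d] by meson
    have "vnorm Y (\<Sum>n\<in>F. act (a n) (x n)) < e" if F: "finite F" "F \<subseteq> {N..}" for F
    proof -
      have "vnorm X (sum x G) \<le> d" if "G \<subseteq> F" for G
        using N[of G] that F finite_subset by fastforce
      then have "vnorm Y (\<Sum>n\<in>F. act (a n) (x n)) \<le> K * C * d"
        using F(1) x a C d by (intro bound) auto
      also have "\<dots> \<le> \<bar>K\<bar> * C * d"
        using C d by (intro mult_right_mono) auto
      also have "\<dots> < (\<bar>K\<bar> * C + 1) * d" using d by simp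
      also have "\<dots> = e" using KC by (simp add: d_def)
      finally show ?thesis .
    qed
    then show "\<exists>N. \<forall>F. finite F \<longrightarrow> F \<subseteq> {N..} \<longrightarrow> vnorm Y (\<Sum>n\<in>F. act (a n) (x n)) < e" by blast
  qed
qed

text \<open>
  Conversely, preservation forces a uniform finite inequality: otherwise, for each \<open>i\<close>, some finite
  family has subset sums of norm at most \<open>(1/2)\<^sup>i\<close> but products summing to norm at least \<open>1\<close>. Listed
  one after the other, these families form an unconditionally convergent series, because a finite
  set beyond the first \<open>I\<close> families has a sum of norm at most \<open>\<Sum>i\<ge>I. (1/2)\<^sup>i\<close>, whereas the series
  of products fails the Cauchy criterion. The \<open>n\<close>-th vector of the \<open>i\<close>-th family is put at the
  index \<open>prod_encode (i, n)\<close>, and unused indices carry zero.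
\<close>

lemma preserves_unconditional_convergenceD:
  assumes action: "banach_action A X Y act"
    and pres: "preserves_unconditional_convergence A X Y act"
  obtains d :: real where "0 < d"
    and "\<And>(F :: nat set) x a. finite F \<Longrightarrow> (\<And>n. n \<in> F \<Longrightarrow> x n \<in> carrier X) \<Longrightarrow>
      (\<And>n. n \<in> F \<Longrightarrow> a n \<in> carrier A) \<Longrightarrow> (\<And>n. n \<in> F \<Longrightarrow> vnorm A (a n) \<le> 1) \<Longrightarrow>
      (\<And>G. G \<subseteq> F \<Longrightarrow> vnorm X (sum x G) \<le> d) \<Longrightarrow> vnorm Y (\<Sum>n\<in>F. act (a n) (x n)) < 1"
proof (rule ccontr)
  interpret A: banach_space A using action by (simp add: banach_action_def)
  interpret X: banach_space X using action by (simp add: banach_action_def)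
  interpret Y: banach_space Y using action by (simp add: banach_action_def)
  assume no: "\<not> thesis"
  define admissible where "admissible F x a d \<longleftrightarrow> finite F \<and> (\<forall>n\<in>F. x n \<in> carrier X) \<and>
      (\<forall>n\<in>F. a n \<in> carrier A) \<and> (\<forall>n\<in>F. vnorm A (a n) \<le> 1) \<and>
      (\<forall>G. G \<subseteq> F \<longrightarrow> vnorm X (sum x G) \<le> d)" for F :: "nat set" and x a d
  have "\<exists>F x a. admissible F x a ((1/2) ^ i) \<and> 1 \<le> vnorm Y (\<Sum>n\<in>F. act (a n) (x n))" for i :: nat
  proof (rule ccontr)
    assume none: "\<not> ?thesis"
    have thesis
    proof (rule that)
      show "0 < (1/2 :: real) ^ i" by simp
      fix F :: "nat set" and x a
      assume "finite F" "\<And>n. n \<in> F \<Longrightarrow> x n \<in> carrier X" "\<And>n. n \<in> F \<Longrightarrow> a n \<in> carrier A"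
        "\<And>n. n \<in> F \<Longrightarrow> vnorm A (a n) \<le> 1" "\<And>G. G \<subseteq> F \<Longrightarrow> vnorm X (sum x G) \<le> (1/2) ^ i"
      then have "admissible F x a ((1/2) ^ i)" by (simp add: admissible_def)
      then show "vnorm Y (\<Sum>n\<in>F. act (a n) (x n)) < 1" using none by (meson not_le)
    qed
    with no show False by (rule notE)
  qed
  then obtain F x a where adm: "\<And>i. admissible (F i) (x i) (a i) ((1/2) ^ i)"
    and big: "\<And>i. 1 \<le> vnorm Y (\<Sum>n\<in>F i. act (a i n) (x i n))"
    by metis
  have fin: "finite (F i)" and x: "n \<in> F i \<Longrightarrow> x i n \<in> carrier X"
    and a: "n \<in> F i \<Longrightarrow> a i n \<in> carrier A" "n \<in> F i \<Longrightarrow> vnorm A (a i n) \<le> 1"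
    and small: "G \<subseteq> F i \<Longrightarrow> vnorm X (sum (x i) G) \<le> (1/2) ^ i" for i n G
    using adm[of i] by (auto simp: admissible_def)
  define xx where "xx m = (case prod_decode m of (i, n) \<Rightarrow> if n \<in> F i then x i n else 0)" for m
  define aa where "aa m = (case prod_decode m of (i, n) \<Rightarrow> if n \<in> F i then a i n else 0)" for m
  have inj: "inj_on prod_encode S" for S using inj_prod_encode .
  have mem: "xx m \<in> carrier X" for m
    using x X.subspace_0[OF X.subspace_carrier] by (auto simp: xx_def split: prod.splits)
  have "converges_unconditionally X xx"
    unfolding X.converges_unconditionally_iff_unordered_Cauchy
  proof (intro conjI allI impI)
    show "range xx \<subseteq> carrier X" using mem by blast
    fix e :: real assume "0 < e"
    then obtain I where I: "(1/2) ^ I < e / 2"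
      using real_arch_pow_inv[of "e/2" "1/2"] by auto
    have "finite (prod_encode ` (SIGMA i:{..<I}. F i))" using fin by auto
    then obtain N where N: "\<And>m. m \<in> prod_encode ` (SIGMA i:{..<I}. F i) \<Longrightarrow> m < N"
      by (metis finite_nat_set_iff_bounded)
    have "vnorm X (sum xx S) < e" if S: "finite S" "S \<subseteq> {N..}" for S
    proof -
      define G where "G i = {n \<in> F i. prod_encode (i, n) \<in> S}" for i
      obtain M where M: "\<And>m. m \<in> S \<Longrightarrow> m < M" using S(1) by (metis finite_nat_set_iff_bounded)
      have G: "finite (G i)" for i using fin by (simp add: G_def)
      have sub: "prod_encode ` (SIGMA i:{I..<I+M}. G i) \<subseteq> S" by (auto simp: G_def)
      have "sum xx S = sum xx (prod_encode ` (SIGMA i:{I..<I+M}. G i))"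
      proof (intro sum.mono_neutral_right S(1) sub ballI)
        fix m assume m: "m \<in> S - prod_encode ` (SIGMA i:{I..<I+M}. G i)"
        obtain i n where m': "m = prod_encode (i, n)" by (metis prod_decode_inverse surj_pair)
        have "n \<notin> F i"
        proof
          assume n: "n \<in> F i"
          then have "n \<in> G i" using m m' by (simp add: G_def)
          moreover have "i < M" using le_prod_encode_1[of i n] M[of m] m m' by simp
          moreover have "I \<le> i"
          proof (rule ccontr)
            assume "\<not> I \<le> i"
            then have "m < N" using n m' by (intro N) auto
            then show False using m S(2) by auto
          qed
          ultimately show False using m m' by auto
        qed
        then show "xx m = 0" by (simp add: xx_def m')
      qed
      also have "\<dots> = (\<Sum>(i, n)\<in>(SIGMA i:{I..<I+M}. G i). x i n)"
        unfolding sum.reindex[OF inj] by (intro sum.cong) (auto simp: xx_def G_def)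
      also have "\<dots> = (\<Sum>i=I..<I+M. \<Sum>n\<in>G i. x i n)"
        using G by (intro sum.Sigma[symmetric]) auto
      finally have "vnorm X (sum xx S) \<le> (\<Sum>i=I..<I+M. vnorm X (\<Sum>n\<in>G i. x i n))"
        using x by (auto intro!: X.vnorm_sum X.sum_carrier simp: G_def)
      also have "\<dots> \<le> (\<Sum>i=I..<I+M. (1/2) ^ i)"
        by (intro sum_mono small) (auto simp: G_def)
      also have "\<dots> = 2 * (1/2) ^ I - 2 * (1/2) ^ (I + M)"
        by (induction M) auto
      also have "\<dots> \<le> 2 * (1/2) ^ I" by simp
      also have "\<dots> < e" using I by simp
      finally show ?thesis .
    qed
    then show "\<exists>N. \<forall>S. finite S \<longrightarrow> S \<subseteq> {N..} \<longrightarrow> vnorm X (sum xx S) < e" by blast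
  qed
  moreover have "bounded_sequence A aa"
    using a A.subspace_0[OF A.subspace_carrier]
    by (auto simp: bounded_sequence_def aa_def A.vnorm_zero split: prod.splits intro!: exI[of _ 1])
  ultimately have "converges_unconditionally Y (\<lambda>m. act (aa m) (xx m))"
    using pres by (simp add: preserves_unconditional_convergence_def)
  then obtain N where N: "\<And>S. finite S \<Longrightarrow> S \<subseteq> {N..} \<Longrightarrow> vnorm Y (\<Sum>m\<in>S. act (aa m) (xx m)) < 1"
    unfolding Y.converges_unconditionally_iff_unordered_Cauchy by (meson zero_less_one)
  have "vnorm Y (\<Sum>m\<in>prod_encode ` Pair N ` F N. act (aa m) (xx m)) < 1"
    using fin le_prod_encode_1 by (intro N) auto
  also have "(\<Sum>m\<in>prod_encode ` Pair N ` F N. act (aa m) (xx m)) = (\<Sum>n\<in>F N. act (a N n) (x N n))"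
    unfolding image_image
    by (subst sum.reindex) (auto simp: inj_on_def aa_def xx_def)
  finally show False using big[of N] by simp
qed

section \<open>Khinchine's inequality\<close>

text \<open>
  For independent random signs \<open>\<epsilon>\<close> and \<open>v = (\<Sum>k<K. \<parallel>c n k\<parallel>\<^sup>2)\<close>, the random sum
  \<open>T = S + (\<Sum>k<K. \<epsilon> k c n k)\<close> satisfies \<open>E \<parallel>T\<parallel>\<^sup>2 = \<parallel>S\<parallel>\<^sup>2 + v\<close> and
  \<open>E \<parallel>T\<parallel>\<^sup>4 \<le> \<parallel>S\<parallel>\<^sup>4 + 6 \<parallel>S\<parallel>\<^sup>2 v + 3 v\<^sup>2\<close>. The left-hand side is therefore a lower bound for the expectation
  of the right-hand side, and some choice of signs does at least as well as the average. The signs are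
  picked one at a time, keeping the conditional lower bound from decreasing.
\<close>

lemma signs_beat_second_fourth_moment:
  fixes c :: "'n \<Rightarrow> nat \<Rightarrow> 'v::real_inner" and S :: "'n \<Rightarrow> 'v" and A B :: "'n \<Rightarrow> real"
  assumes B: "\<And>n. 0 \<le> B n"
  shows "\<exists>\<epsilon> :: nat \<Rightarrow> real. (\<forall>k. \<bar>\<epsilon> k\<bar> = 1) \<and>
    (\<Sum>n\<in>F. A n * ((norm (S n))\<^sup>2 + (\<Sum>k<K. (norm (c n k))\<^sup>2)) -
       B n * ((norm (S n)) ^ 4 + 6 * (norm (S n))\<^sup>2 * (\<Sum>k<K. (norm (c n k))\<^sup>2) + 3 * (\<Sum>k<K. (norm (c n k))\<^sup>2)\<^sup>2))
    \<le> (\<Sum>n\<in>F. A n * (norm (S n + (\<Sum>k<K. \<epsilon> k *\<^sub>R c n k)))\<^sup>2 - B n * norm (S n + (\<Sum>k<K. \<epsilon> k *\<^sub>R c n k)) ^ 4)"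
proof (induction K arbitrary: S)
  case 0
  show ?case by (intro exI[of _ "\<lambda>_. 1"]) auto
next
  case (Suc K)
  define V where "V n = (\<Sum>k<K. (norm (c n k))\<^sup>2)" for n
  define \<Psi> where "\<Psi> n v T = A n * ((norm T)\<^sup>2 + v) - B n * ((norm T) ^ 4 + 6 * (norm T)\<^sup>2 * v + 3 * v\<^sup>2)"
    for n v and T :: 'v
  have avg: "2 * \<Psi> n (V n + (norm (c n K))\<^sup>2) (S n) \<le> \<Psi> n (V n) (S n + c n K) + \<Psi> n (V n) (S n - c n K)" for n
  proof -
    define s b d where "s = (norm (S n))\<^sup>2" and "b = (norm (c n K))\<^sup>2" and "d = S n \<bullet> c n K"
    have sq: "(norm (S n + c n K))\<^sup>2 = s + b + 2 * d" "(norm (S n - c n K))\<^sup>2 = s + b - 2 * d"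
      by (simp_all add: s_def b_def d_def power2_norm_eq_inner inner_add_left inner_add_right
          inner_diff_left inner_diff_right inner_commute)
    have four: "norm T ^ 4 = ((norm T)\<^sup>2)\<^sup>2" for T :: 'v by simp
    have "d\<^sup>2 \<le> s * b"
      using Cauchy_Schwarz_ineq[of "S n" "c n K"] by (simp add: s_def b_def d_def power2_norm_eq_inner)
    then have "0 \<le> 2 * B n * (4 * (s * b - d\<^sup>2) + 2 * b\<^sup>2)"
      using B by (intro mult_nonneg_nonneg) auto
    also have "\<dots> = \<Psi> n (V n) (S n + c n K) + \<Psi> n (V n) (S n - c n K) - 2 * \<Psi> n (V n + b) (S n)"
      unfolding \<Psi>_def four sq s_def[symmetric] by (simp add: power2_eq_square algebra_simps)
    finally show ?thesis by (simp add: b_def)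
  qed
  obtain s :: real where s: "\<bar>s\<bar> = 1"
    "(\<Sum>n\<in>F. \<Psi> n (V n + (norm (c n K))\<^sup>2) (S n)) \<le> (\<Sum>n\<in>F. \<Psi> n (V n) (S n + s *\<^sub>R c n K))"
  proof -
    have "2 * (\<Sum>n\<in>F. \<Psi> n (V n + (norm (c n K))\<^sup>2) (S n))
        \<le> (\<Sum>n\<in>F. \<Psi> n (V n) (S n + c n K)) + (\<Sum>n\<in>F. \<Psi> n (V n) (S n - c n K))"
      unfolding sum_distrib_left sum.distrib[symmetric] by (intro sum_mono avg)
    then consider "(\<Sum>n\<in>F. \<Psi> n (V n + (norm (c n K))\<^sup>2) (S n)) \<le> (\<Sum>n\<in>F. \<Psi> n (V n) (S n + c n K))"
      | "(\<Sum>n\<in>F. \<Psi> n (V n + (norm (c n K))\<^sup>2) (S n)) \<le> (\<Sum>n\<in>F. \<Psi> n (V n) (S n - c n K))" by linarith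
    then show ?thesis by cases (use that[of 1] that[of "-1"] in auto)
  qed
  obtain \<epsilon> :: "nat \<Rightarrow> real" where \<epsilon>: "\<And>k. \<bar>\<epsilon> k\<bar> = 1"
    "(\<Sum>n\<in>F. \<Psi> n (V n) (S n + s *\<^sub>R c n K)) \<le>
     (\<Sum>n\<in>F. A n * (norm (S n + s *\<^sub>R c n K + (\<Sum>k<K. \<epsilon> k *\<^sub>R c n k)))\<^sup>2
              - B n * norm (S n + s *\<^sub>R c n K + (\<Sum>k<K. \<epsilon> k *\<^sub>R c n k)) ^ 4)"
    using Suc.IH[of "\<lambda>n. S n + s *\<^sub>R c n K"] unfolding \<Psi>_def V_def by blast
  have eq: "S n + s *\<^sub>R c n K + (\<Sum>k<K. \<epsilon> k *\<^sub>R c n k) = S n + (\<Sum>k<Suc K. (\<epsilon>(K := s)) k *\<^sub>R c n k)" for n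
    by simp
  show ?case
  proof (intro exI[of _ "\<epsilon>(K := s)"] conjI allI)
    show "\<bar>(\<epsilon>(K := s)) k\<bar> = 1" for k using \<epsilon>(1) s(1) by simp
  qed (use order_trans[OF s(2) \<epsilon>(2)] in \<open>unfold eq \<Psi>_def V_def, simp only: sum.lessThan_Suc\<close>)
qed

text \<open>
  Khinchine's inequality between the first and the second moment, simultaneously for a finite family
  of sums: with \<open>\<sigma>\<close> the standard deviation, the bound \<open>t \<ge> t\<^sup>2 / \<sigma> - t\<^sup>4 / (4 \<sigma>\<^sup>3)\<close> for \<open>t \<ge> 0\<close> reduces the
  first moment to the second and fourth ones, which give \<open>\<sigma> - 3 \<sigma> / 4\<close>.
\<close>

lemma ex_signs_Khinchine:
  fixes c :: "'n \<Rightarrow> nat \<Rightarrow> 'v::real_inner"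
  obtains \<epsilon> :: "nat \<Rightarrow> real" where "\<And>k. \<bar>\<epsilon> k\<bar> = 1"
    and "(\<Sum>n\<in>F. L2_set (\<lambda>k. norm (c n k)) {..<K}) \<le> 4 * (\<Sum>n\<in>F. norm (\<Sum>k<K. \<epsilon> k *\<^sub>R c n k))"
proof -
  define \<sigma> where "\<sigma> n = L2_set (\<lambda>k. norm (c n k)) {..<K}" for n
  have \<sigma>: "0 \<le> \<sigma> n" "(\<Sum>k<K. (norm (c n k))\<^sup>2) = (\<sigma> n)\<^sup>2" for n
    by (simp_all add: \<sigma>_def L2_set_nonneg L2_set_def sum_nonneg)
  obtain \<epsilon> :: "nat \<Rightarrow> real" where \<epsilon>: "\<And>k. \<bar>\<epsilon> k\<bar> = 1" and
    le: "(\<Sum>n\<in>F. 1 / \<sigma> n * (\<sigma> n)\<^sup>2 - 1 / (4 * \<sigma> n ^ 3) * (3 * ((\<sigma> n)\<^sup>2)\<^sup>2))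
     \<le> (\<Sum>n\<in>F. 1 / \<sigma> n * (norm (\<Sum>k<K. \<epsilon> k *\<^sub>R c n k))\<^sup>2 - 1 / (4 * \<sigma> n ^ 3) * norm (\<Sum>k<K. \<epsilon> k *\<^sub>R c n k) ^ 4)"
    using signs_beat_second_fourth_moment[where A = "\<lambda>n. 1 / \<sigma> n" and B = "\<lambda>n. 1 / (4 * \<sigma> n ^ 3)"
        and S = "\<lambda>_. 0" and c = c and F = F and K = K] \<sigma> by auto
  have left: "1 / \<sigma> n * (\<sigma> n)\<^sup>2 - 1 / (4 * \<sigma> n ^ 3) * (3 * ((\<sigma> n)\<^sup>2)\<^sup>2) = \<sigma> n / 4" for n
    by (cases "\<sigma> n = 0") (simp_all add: field_simps power2_eq_square power3_eq_cube)
  have right: "1 / s * t\<^sup>2 - 1 / (4 * s ^ 3) * t ^ 4 \<le> t" if "0 \<le> s" "0 \<le> t" for s t :: real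
  proof (cases "s = 0")
    case False
    define u where "u = t / s"
    have u: "0 \<le> u" "t = u * s" using that False by (auto simp: u_def)
    \<comment> \<open>\<open>u\<^sup>3 / 4 - u + 1\<close> is positive for \<open>u \<ge> 0\<close>; its minimum is at \<open>2 / \<surd>3\<close>, close to \<open>7/6\<close>\<close>
    have "0 \<le> (u - 7/6)\<^sup>2 * (u + 7/3)" using u by simp
    also have "\<dots> = u ^ 3 - 49/12 * u + 343/108"
      by (simp add: power2_eq_square power3_eq_cube field_simps)
    finally have "u - 1 \<le> u ^ 3 / 4" using u(1) by simp
    then have "u * s * (u - 1) \<le> u * s * (u ^ 3 / 4)"
      using u that by (intro mult_left_mono) auto
    then show ?thesis
      using False u by (simp add: field_simps power2_eq_square power3_eq_cube power4_eq_xxxx)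
  qed (use that in simp)
  have "(\<Sum>n\<in>F. \<sigma> n) / 4 \<le> (\<Sum>n\<in>F. norm (\<Sum>k<K. \<epsilon> k *\<^sub>R c n k))"
    using order_trans[OF le sum_mono[OF right]] \<sigma>(1) unfolding left sum_divide_distrib by simp
  then show ?thesis using that[of \<epsilon>] \<epsilon> by (simp add: \<sigma>_def)
qed

section \<open>Preservation for exponents at most two and for infinity\<close>

text \<open>
  A form of Young's inequality whose constants need no conjugate exponent, so that \<open>r = 1\<close> is
  included: one of the two summands dominates according to whether \<open>y \<le> t * z\<close>.
\<close>

lemma powr_Young:
  fixes y z t :: real
  assumes "1 \<le> r" "0 \<le> y" "0 \<le> z" "0 < t"
  shows "z powr (r - 1) * y \<le> t * z powr r + t powr (1 - r) * y powr r"
proof (cases "y \<le> t * z")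
  case True
  have "z powr (r - 1) * y \<le> z powr (r - 1) * (t * z)" using True by (intro mult_left_mono) auto
  also have "\<dots> = t * z powr r" using assms by (cases "z = 0") (auto simp: powr_diff)
  also have "\<dots> \<le> t * z powr r + t powr (1 - r) * y powr r" by simp
  finally show ?thesis .
next
  case False
  then have y: "0 < y" using assms by (meson less_le_trans mult_nonneg_nonneg not_le order_less_imp_le)
  have "z powr (r - 1) * y \<le> (y / t) powr (r - 1) * y"
    using assms False by (intro mult_right_mono powr_mono2) (auto simp: field_simps)
  also have "\<dots> = t powr (1 - r) * y powr r"
    using assms y by (simp add: powr_divide powr_diff)
  also have "\<dots> \<le> t * z powr r + t powr (1 - r) * y powr r" using assms by simp
  finally show ?thesis .
qed

text \<open>
  With \<open>z k = (\<Sum>n\<in>F. \<parallel>a n k\<parallel> \<parallel>x n k\<parallel>)\<close> and the weights \<open>\<beta> k = z k powr (r - 1)\<close>, the sum \<open>Z\<close> to be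
  bounded is \<open>\<Sum>k. \<beta> k * z k\<close>, which by Cauchy--Schwarz is at most \<open>C\<close> times the sum over \<open>n\<close> of the
  Euclidean norms of \<open>\<beta> x n\<close>. By Khinchine's inequality these norms are controlled by
  scalars \<open>\<Sum>k. \<epsilon> k \<beta> k x n k\<close>, and the subset sums of those scalars pair \<open>\<beta>\<close> with the subset sums of \<open>x\<close>.
  The bound so obtained is a small multiple of \<open>Z\<close> plus the wanted quantity.
\<close>

lemma sum_powr_multiplier_le:
  fixes x a :: "'n \<Rightarrow> nat \<Rightarrow> 'v::euclidean_space" and C e :: real
  assumes r: "1 \<le> r" and F: "finite F" and C: "0 < C" and e: "0 < e"
    and x: "\<And>G. G \<subseteq> F \<Longrightarrow> (\<Sum>k<K. norm (\<Sum>n\<in>G. x n k) powr r) \<le> e powr r"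
    and a: "\<And>n. n \<in> F \<Longrightarrow> L2_set (\<lambda>k. norm (a n k)) {..<K} \<le> C"
  shows "(\<Sum>k<K. (\<Sum>n\<in>F. norm (a n k) * norm (x n k)) powr r) \<le> (16 * real DIM('v) * C * e) powr r"
proof -
  define z where "z k = (\<Sum>n\<in>F. norm (a n k) * norm (x n k))" for k
  have z: "0 \<le> z k" for k by (simp add: z_def sum_nonneg)
  define \<beta> where "\<beta> k = z k powr (r - 1)" for k
  define Z where "Z = (\<Sum>k<K. z k powr r)"
  define B where "B = 8 * real DIM('v) * C"
  have B: "0 < B" using C by (simp add: B_def)
  \<comment> \<open>with this \<open>t\<close>, the bound \<open>Z \<le> B * E\<close> contains \<open>Z\<close> with the factor 1/2 only, which is absorbed\<close>
  define t where "t = 1 / (2 * B)"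
  have t: "0 < t" using B by (simp add: t_def)
  define E where "E = t * Z + t powr (1 - r) * e powr r"
  obtain \<epsilon> :: "nat \<Rightarrow> real" where \<epsilon>: "\<And>k. \<bar>\<epsilon> k\<bar> = 1" and
    Khinchine: "(\<Sum>n\<in>F. L2_set (\<lambda>k. norm (\<beta> k *\<^sub>R x n k)) {..<K})
      \<le> 4 * (\<Sum>n\<in>F. norm (\<Sum>k<K. \<epsilon> k *\<^sub>R \<beta> k *\<^sub>R x n k))"
    by (rule ex_signs_Khinchine[where c = "\<lambda>n k. \<beta> k *\<^sub>R x n k" and F = F and K = K]) blast
  have sub: "norm (\<Sum>n\<in>G. \<Sum>k<K. \<epsilon> k *\<^sub>R \<beta> k *\<^sub>R x n k) \<le> E" if G: "G \<subseteq> F" for G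
  proof -
    have "(\<Sum>n\<in>G. \<Sum>k<K. \<epsilon> k *\<^sub>R \<beta> k *\<^sub>R x n k) = (\<Sum>k<K. \<epsilon> k *\<^sub>R \<beta> k *\<^sub>R (\<Sum>n\<in>G. x n k))"
      by (subst sum.swap) (simp add: scaleR_sum_right)
    then have "norm (\<Sum>n\<in>G. \<Sum>k<K. \<epsilon> k *\<^sub>R \<beta> k *\<^sub>R x n k) \<le> (\<Sum>k<K. \<beta> k * norm (\<Sum>n\<in>G. x n k))"
      by (auto intro!: sum_norm_le simp: \<epsilon> \<beta>_def abs_mult)
    also have "\<dots> \<le> (\<Sum>k<K. t * z k powr r + t powr (1 - r) * norm (\<Sum>n\<in>G. x n k) powr r)"
      unfolding \<beta>_def by (intro sum_mono powr_Young r z t) auto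
    also have "\<dots> = t * Z + t powr (1 - r) * (\<Sum>k<K. norm (\<Sum>n\<in>G. x n k) powr r)"
      by (simp add: Z_def sum.distrib sum_distrib_left)
    also have "\<dots> \<le> E" unfolding E_def by (intro add_left_mono mult_left_mono x G) simp
    finally show ?thesis .
  qed
  have "Z = (\<Sum>k<K. \<beta> k * z k)"
    unfolding Z_def \<beta>_def using z by (intro sum.cong) (auto simp: powr_diff)
  also have "\<dots> = (\<Sum>n\<in>F. \<Sum>k<K. \<bar>norm (a n k)\<bar> * \<bar>norm (\<beta> k *\<^sub>R x n k)\<bar>)"
    unfolding z_def sum_distrib_left by (subst sum.swap) (simp add: \<beta>_def mult_ac)
  also have "\<dots> \<le> (\<Sum>n\<in>F. L2_set (\<lambda>k. norm (a n k)) {..<K} * L2_set (\<lambda>k. norm (\<beta> k *\<^sub>R x n k)) {..<K})"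
    by (intro sum_mono L2_set_mult_ineq)
  also have "\<dots> \<le> (\<Sum>n\<in>F. C * L2_set (\<lambda>k. norm (\<beta> k *\<^sub>R x n k)) {..<K})"
    using a by (intro sum_mono mult_right_mono) (auto simp: L2_set_nonneg)
  also have "\<dots> \<le> C * (4 * (\<Sum>n\<in>F. norm (\<Sum>k<K. \<epsilon> k *\<^sub>R \<beta> k *\<^sub>R x n k)))"
    unfolding sum_distrib_left[symmetric] using C Khinchine by (intro mult_left_mono) auto
  also have "\<dots> \<le> C * (4 * (2 * real DIM('v) * E))"
    by (intro mult_left_mono sum_norm_allsubsets_bound F sub) (use C in auto)
  also have "\<dots> = B * t * Z + B * t powr (1 - r) * e powr r"
    by (simp add: B_def E_def algebra_simps)
  also have "B * t = 1/2" using B by (simp add: t_def)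
  finally have "Z \<le> 2 * B * t powr (1 - r) * e powr r" by simp
  also have "2 * B * t powr (1 - r) = (2 * B) powr r"
    using B by (simp add: t_def powr_divide powr_diff)
  also have "\<dots> * e powr r = (16 * real DIM('v) * C * e) powr r"
    by (simp add: powr_mult[symmetric] B_def mult_ac)
  finally show ?thesis by (simp add: Z_def z_def)
qed

lemma sum_fun_apply: "(\<Sum>i\<in>S. f i) k = (\<Sum>i\<in>S. f i k)"
  by (induction S rule: infinite_finite_induct) auto

text \<open>
  The hypothesis \<open>p \<le> 2\<close> enters through \<open>\<parallel>a\<parallel>\<^sub>2 \<le> \<parallel>a\<parallel>\<^sub>p\<close>.
\<close>

lemma preserves_lp_le_2:
  assumes p: "1 \<le> p" "p \<le> 2"
  shows "preserves_unconditional_convergence (lp p) (lp p) (lp p)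
    (coordinatewise_mult :: (nat \<Rightarrow> 'k::{real_normed_field, euclidean_space}) \<Rightarrow> _)"
proof -
  obtain r where r: "p = ereal r" "1 \<le> r" "r \<le> 2"
    using p by (cases p) auto
  show ?thesis
  proof (rule preserves_unconditional_convergenceI[OF banach_action_coordinatewise_mult[OF p(1)]])
    fix F :: "nat set" and x a :: "nat \<Rightarrow> nat \<Rightarrow> 'k" and C e :: real
    assume *: "finite F" "\<And>n. n \<in> F \<Longrightarrow> x n \<in> carrier (lp p)" "\<And>n. n \<in> F \<Longrightarrow> a n \<in> carrier (lp p)"
      "0 < C" "0 < e" "\<And>n. n \<in> F \<Longrightarrow> vnorm (lp p) (a n) \<le> C"
      "\<And>G. G \<subseteq> F \<Longrightarrow> vnorm (lp p) (sum x G) \<le> e"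
    interpret banach_space "lp p :: ('k, nat \<Rightarrow> 'k) normed_structure" using p(1) by (rule banach_space_lp)
    have "(\<Sum>k<K. norm ((\<Sum>n\<in>F. coordinatewise_mult (a n) (x n)) k) powr r) \<le> (16 * real DIM('k) * C * e) powr r" for K
    proof -
      have "(\<Sum>k<K. norm ((\<Sum>n\<in>F. coordinatewise_mult (a n) (x n)) k) powr r)
          \<le> (\<Sum>k<K. (\<Sum>n\<in>F. norm (a n k) * norm (x n k)) powr r)"
        using r(2) by (intro sum_mono powr_mono2)
          (auto simp: sum_fun_apply coordinatewise_mult_def norm_mult intro!: sum_norm_le)
      also have "\<dots> \<le> (16 * real DIM('k) * C * e) powr r"
      proof (rule sum_powr_multiplier_le[OF r(2) *(1,4,5)])
        fix G assume G: "G \<subseteq> F"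
        have "sum x G \<in> carrier (lp p)" using * G by (intro sum_carrier) auto
        then show "(\<Sum>k<K. norm (\<Sum>n\<in>G. x n k) powr r) \<le> e powr r"
          using lp_real_ball_iff[OF r(2), of e "sum x G"] *(5) *(7)[OF G] r(1)
          by (simp add: lp_def sum_fun_apply)
      next
        fix n assume n: "n \<in> F"
        have fin: "lp_finite p (a n)" and le: "lp_norm p (a n) \<le> C" using *(3,6)[OF n] by (auto simp: lp_def)
        have "(norm (a n k))\<^sup>2 \<le> C powr (2 - r) * norm (a n k) powr r" for k
        proof -
          have "norm (a n k) \<le> C" using norm_le_lp_norm[OF p(1) fin, of k] le by simp
          then have "norm (a n k) powr (2 - r) * norm (a n k) powr r \<le> C powr (2 - r) * norm (a n k) powr r"
            using r by (intro mult_right_mono powr_mono2) auto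
          also have "norm (a n k) powr (2 - r) * norm (a n k) powr r = (norm (a n k))\<^sup>2"
            by (cases "a n k = 0") (auto simp: powr_add[symmetric])
          finally show ?thesis .
        qed
        then have "(\<Sum>k<K. (norm (a n k))\<^sup>2) \<le> (\<Sum>k<K. C powr (2 - r) * norm (a n k) powr r)"
          by (intro sum_mono)
        also have "\<dots> \<le> C powr (2 - r) * C powr r"
          using lp_real_ball_iff[OF r(2), of C "a n"] fin le *(4) r(1)
          by (auto simp: sum_distrib_left[symmetric] intro!: mult_left_mono)
        also have "\<dots> = C\<^sup>2" using *(4) by (simp add: powr_add[symmetric])
        finally show "L2_set (\<lambda>k. norm (a n k)) {..<K} \<le> C"
          using *(4) unfolding L2_set_def by (intro real_le_lsqrt) auto
      qed
      finally show ?thesis .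
    qed
    then show "vnorm (lp p) (\<Sum>n\<in>F. coordinatewise_mult (a n) (x n)) \<le> 16 * real DIM('k) * C * e"
      using lp_real_ball_iff[OF r(2), of "16 * real DIM('k) * C * e" "\<Sum>n\<in>F. coordinatewise_mult (a n) (x n)"]
        *(4,5) r(1) by (simp add: lp_def)
  qed
qed

lemma preserves_lp_infinity:
  "preserves_unconditional_convergence (lp \<infinity>) (lp \<infinity>) (lp \<infinity>)
    (coordinatewise_mult :: (nat \<Rightarrow> 'k::{real_normed_field, euclidean_space}) \<Rightarrow> _)"
proof (rule preserves_unconditional_convergenceI[OF banach_action_coordinatewise_mult])
  fix F :: "nat set" and x a :: "nat \<Rightarrow> nat \<Rightarrow> 'k" and C e :: real
  assume *: "finite F" "\<And>n. n \<in> F \<Longrightarrow> x n \<in> carrier (lp \<infinity>)" "\<And>n. n \<in> F \<Longrightarrow> a n \<in> carrier (lp \<infinity>)"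
    "0 < C" "0 < e" "\<And>n. n \<in> F \<Longrightarrow> vnorm (lp \<infinity>) (a n) \<le> C"
    "\<And>G. G \<subseteq> F \<Longrightarrow> vnorm (lp \<infinity>) (sum x G) \<le> e"
  interpret banach_space "lp \<infinity> :: ('k, nat \<Rightarrow> 'k) normed_structure" by (rule banach_space_lp) simp
  have "norm ((\<Sum>n\<in>F. coordinatewise_mult (a n) (x n)) k) \<le> 2 * real DIM('k) * C * e" for k
  proof -
    have a: "norm (a n k) \<le> C" if "n \<in> F" for n
      using lp_infinity_ball_iff[of "a n" C] *(3,6)[OF that] by (simp add: lp_def)
    have x: "norm (\<Sum>n\<in>G. x n k) \<le> e" if G: "G \<subseteq> F" for G
    proof -
      have "sum x G \<in> carrier (lp \<infinity>)" using * G by (intro sum_carrier) auto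
      then show ?thesis
        using lp_infinity_ball_iff[of "sum x G" e] *(7)[OF G] by (simp add: lp_def sum_fun_apply)
    qed
    have "norm ((\<Sum>n\<in>F. coordinatewise_mult (a n) (x n)) k) \<le> (\<Sum>n\<in>F. C * norm (x n k))"
      using a by (auto simp: sum_fun_apply coordinatewise_mult_def norm_mult intro!: sum_norm_le mult_right_mono)
    also have "\<dots> \<le> C * (2 * real DIM('k) * e)"
      unfolding sum_distrib_left[symmetric]
      using *(4) sum_norm_allsubsets_bound[OF *(1) x] by (intro mult_left_mono) auto
    finally show ?thesis by (simp add: mult_ac)
  qed
  then show "vnorm (lp \<infinity>) (\<Sum>n\<in>F. coordinatewise_mult (a n) (x n)) \<le> 2 * real DIM('k) * C * e"
    using lp_infinity_ball_iff[of "\<Sum>n\<in>F. coordinatewise_mult (a n) (x n)" "2 * real DIM('k) * C * e"]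
    by (simp add: lp_def)
qed simp

section \<open>Failure for finite exponents above two\<close>

text \<open>
  For \<open>N\<close> divisible by \<open>2\<^sup>j\<close>, the matrix \<open>walsh j\<close> of size \<open>N\<close> is block diagonal, with
  Walsh--Hadamard matrices of size \<open>2\<^sup>j\<close> as blocks. The recursion is the Kronecker product with the
  matrix with rows \<open>1, 1\<close> and \<open>1, -1\<close>.
\<close>

primrec walsh :: "nat \<Rightarrow> nat \<Rightarrow> nat \<Rightarrow> real" where
  "walsh 0 n k = (if n = k then 1 else 0)"
| "walsh (Suc j) n k = (if odd n \<and> odd k then -1 else 1) * walsh j (n div 2) (k div 2)"

lemma walsh_commute: "walsh j n k = walsh j k n"
  by (induction j arbitrary: n k) auto

lemma walsh_cases: "walsh j n k \<in> {-1, 0, 1}"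
  by (induction j arbitrary: n k) auto

lemma sum_lessThan_double: "(\<Sum>n<2 * M. f n) = (\<Sum>n<M. f (2 * n) + f (2 * n + 1))"
  for f :: "nat \<Rightarrow> 'a::comm_monoid_add"
  by (induction M) (auto simp: add.assoc)

lemma sum_abs_walsh:
  assumes "k < 2 ^ j * M"
  shows "(\<Sum>n<2 ^ j * M. \<bar>walsh j n k\<bar>) = 2 ^ j"
  using assms
proof (induction j arbitrary: k)
  case 0
  then show ?case by (simp add: if_distrib cong: if_cong)
next
  case (Suc j)
  then have "k div 2 < 2 ^ j * M" by auto
  then have "(\<Sum>n<2 * (2 ^ j * M). \<bar>walsh (Suc j) n k\<bar>) = 2 * 2 ^ j"
    unfolding sum_lessThan_double using Suc.IH[of "k div 2"]
    by (simp add: abs_mult if_distrib sum_distrib_left[symmetric] cong: if_cong)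
  then show ?case by (simp add: mult.assoc)
qed

text \<open>
  The matrix \<open>walsh j\<close> is \<open>2 powr (j / 2)\<close> times an orthogonal one; each step of the recursion doubles the
  energy by the parallelogram law.
\<close>

lemma sum_norm_walsh_transform:
  fixes s :: "nat \<Rightarrow> 'v::real_inner"
  shows "(\<Sum>k<2 ^ j * M. (norm (\<Sum>n<2 ^ j * M. walsh j n k *\<^sub>R s n))\<^sup>2) = 2 ^ j * (\<Sum>n<2 ^ j * M. (norm (s n))\<^sup>2)"
proof (induction j arbitrary: s)
  case 0
  have "(\<Sum>n<M. (if n = k then 1 else 0) *\<^sub>R s n) = s k" if "k < M" for k
  proof -
    have "(\<Sum>n<M. (if n = k then 1 else 0) *\<^sub>R s n) = (\<Sum>n<M. if n = k then s n else 0)"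
      by (intro sum.cong) auto
    then show ?thesis using that by simp
  qed
  then show ?case by simp
next
  case (Suc j)
  let ?N = "2 ^ j * M"
  define A where "A k = (\<Sum>n<?N. walsh j n k *\<^sub>R s (2 * n))" for k
  define B where "B k = (\<Sum>n<?N. walsh j n k *\<^sub>R s (2 * n + 1))" for k
  have even: "(\<Sum>n<2 * ?N. walsh (Suc j) n (2 * k) *\<^sub>R s n) = A k + B k" for k
    unfolding sum_lessThan_double by (simp add: A_def B_def sum.distrib)
  have odd: "(\<Sum>n<2 * ?N. walsh (Suc j) n (2 * k + 1) *\<^sub>R s n) = A k - B k" for k
    unfolding sum_lessThan_double by (simp add: A_def B_def sum_subtractf)
  have par: "(norm (a + b))\<^sup>2 + (norm (a - b))\<^sup>2 = 2 * ((norm a)\<^sup>2 + (norm b)\<^sup>2)" for a b :: 'v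
    by (simp add: power2_norm_eq_inner inner_add_left inner_add_right inner_diff_left inner_diff_right inner_commute)
  have "(\<Sum>k<2 * ?N. (norm (\<Sum>n<2 * ?N. walsh (Suc j) n k *\<^sub>R s n))\<^sup>2)
      = 2 * ((\<Sum>k<?N. (norm (A k))\<^sup>2) + (\<Sum>k<?N. (norm (B k))\<^sup>2))"
    unfolding sum_lessThan_double[where f = "\<lambda>k. (norm (\<Sum>n<2 * ?N. walsh (Suc j) n k *\<^sub>R s n))\<^sup>2"] even odd par
    by (simp add: sum.distrib sum_distrib_left)
  also have "\<dots> = 2 * 2 ^ j * (\<Sum>n<2 * ?N. (norm (s n))\<^sup>2)"
    unfolding sum_lessThan_double A_def B_def Suc.IH by (simp add: sum.distrib algebra_simps)
  finally show ?case by (simp add: mult.assoc)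
qed

text \<open>
  Let \<open>f\<close> be the sum of the \<open>y j\<close>. The bounds \<open>g ^ j\<close> grow geometrically, so the levels with \<open>g ^ j\<close> much
  smaller than \<open>f\<close> contribute at most half of \<open>f\<close>. On the remaining levels \<open>f powr (r - 2)\<close> is dominated by
  \<open>(g ^ j) powr (r - 2)\<close>, and Cauchy--Schwarz bounds \<open>f\<^sup>2\<close>. Only one factor \<open>L\<close> is lost, whereas the power mean
  inequality applied to \<open>y j powr r \<le> (g ^ j) powr (r - 2) * (y j)\<^sup>2\<close> would lose \<open>L powr (r - 1)\<close>.
\<close>

lemma sum_powr_le_geometric:
  fixes y :: "nat \<Rightarrow> real"
  assumes g: "1 < g" and r: "2 \<le> r" and y: "\<And>j. j < L \<Longrightarrow> 0 \<le> y j" "\<And>j. j < L \<Longrightarrow> y j \<le> g ^ j"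
  shows "(\<Sum>j<L. y j) powr r \<le> 4 * (2 * g / (g - 1)) powr (r - 2) * L * (\<Sum>j<L. (g ^ j) powr (r - 2) * (y j)\<^sup>2)"
proof -
  define f where "f = (\<Sum>j<L. y j)"
  define c where "c = 1 / (g - 1)"
  have c: "0 < c" using g by (simp add: c_def)
  have f: "0 \<le> f" unfolding f_def using y by (intro sum_nonneg) auto
  have head: "(\<Sum>j<I. y j) \<le> c * g ^ I" if "I \<le> L" for I
  proof -
    have "(\<Sum>j<I. y j) \<le> (\<Sum>j<I. g ^ j)" using y that by (intro sum_mono) auto
    also have "\<dots> = c * (g ^ I - 1)" using g by (simp add: geometric_sum c_def)
    also have "\<dots> \<le> c * g ^ I" using c by (intro mult_left_mono) auto
    finally show ?thesis .
  qed
  \<comment> \<open>the levels below \<open>I\<close> are negligible; the truncated subtraction covers \<open>J = 0\<close>, where there are none\<close>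
  define J where "J = (LEAST j. f \<le> 2 * c * g ^ j)"
  define I where "I = J - 1"
  have "f \<le> 2 * c * g ^ L" using head[of L] f c g unfolding f_def by (simp add: mult.assoc)
  then have fJ: "f \<le> 2 * c * g ^ J" and "J \<le> L"
    unfolding J_def by (rule LeastI, rule Least_le)
  then have IL: "I \<le> L" by (simp add: I_def)
  have "2 * (\<Sum>j<I. y j) \<le> f"
  proof (cases "J")
    case 0
    then show ?thesis using f by (simp add: I_def)
  next
    case (Suc i)
    then have "\<not> f \<le> 2 * c * g ^ I" using not_less_Least[of I "\<lambda>j. f \<le> 2 * c * g ^ j"]
      by (simp add: I_def J_def)
    then show ?thesis using head[OF IL] by simp
  qed
  moreover have "f = (\<Sum>j<I. y j) + (\<Sum>j=I..<L. y j)"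
    unfolding f_def using IL by (metis lessThan_atLeast0 sum.atLeastLessThan_concat zero_le)
  ultimately have "f \<le> 2 * (\<Sum>j=I..<L. y j)" by simp
  then have "f\<^sup>2 \<le> (2 * (\<Sum>j=I..<L. y j))\<^sup>2" using f by (intro power_mono)
  also have "\<dots> \<le> 4 * ((\<Sum>j=I..<L. (y j)\<^sup>2) * card {I..<L})"
    using sum_squared_le_sum_of_squares[of y "{I..<L}"] by (simp add: power_mult_distrib)
  also have "\<dots> \<le> 4 * ((\<Sum>j=I..<L. (y j)\<^sup>2) * L)"
    by (intro mult_left_mono sum_nonneg) auto
  finally have f2: "f\<^sup>2 \<le> 4 * L * (\<Sum>j=I..<L. (y j)\<^sup>2)" by (simp add: mult_ac)
  have "g ^ J \<le> g * g ^ I"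
    using g power_increasing[of J "Suc I" g] by (simp add: I_def)
  then have "f \<le> (2 * g / (g - 1)) * g ^ I"
    using fJ c mult_left_mono[of "g ^ J" "g * g ^ I" "2 * c"] by (simp add: c_def)
  then have f': "f powr (r - 2) \<le> (2 * g / (g - 1)) powr (r - 2) * (g ^ I) powr (r - 2)"
    using f r g by (subst powr_mult[symmetric]) (intro powr_mono2, auto)
  have "f powr r = f powr (r - 2) * f\<^sup>2"
  proof (cases "f = 0")
    case False
    then have "f powr (r - 2) * f powr 2 = f powr r" by (simp only: powr_add[symmetric]) simp
    then show ?thesis using f False by simp
  qed simp
  also have "\<dots> \<le> ((2 * g / (g - 1)) powr (r - 2) * (g ^ I) powr (r - 2)) * (4 * L * (\<Sum>j=I..<L. (y j)\<^sup>2))"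
    using f' f2 by (intro mult_mono) auto
  also have "\<dots> = 4 * (2 * g / (g - 1)) powr (r - 2) * L * (\<Sum>j=I..<L. (g ^ I) powr (r - 2) * (y j)\<^sup>2)"
    by (simp add: sum_distrib_left mult_ac)
  also have "\<dots> \<le> 4 * (2 * g / (g - 1)) powr (r - 2) * L * (\<Sum>j=I..<L. (g ^ j) powr (r - 2) * (y j)\<^sup>2)"
    using g r by (intro mult_left_mono sum_mono mult_right_mono powr_mono2 power_increasing) auto
  also have "\<dots> \<le> 4 * (2 * g / (g - 1)) powr (r - 2) * L * (\<Sum>j<L. (g ^ j) powr (r - 2) * (y j)\<^sup>2)"
    by (intro mult_left_mono sum_mono2) auto
  finally show ?thesis by (simp add: f_def)
qed

lemma root_power_powr:
  assumes "2 < (r::real)"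
  shows "1 < 2 powr (1 / r)" "((2 powr (1 / r)) ^ j) powr r = 2 ^ j"
proof -
  show "1 < 2 powr (1 / r)" using assms by simp
  show "((2 powr (1 / r)) ^ j) powr r = 2 ^ j"
    using assms by (simp add: powr_powr flip: powr_realpow)
qed

text \<open>
  The \<open>j\<close>-th summand is at most \<open>g ^ j\<close> at each coordinate, because a row of a block has \<open>2\<^sup>j\<close> entries, and
  its energy is at most \<open>(g ^ j)\<^sup>2 2\<^sup>L / 2\<^sup>j\<close> by orthogonality. As \<open>(g ^ j) powr r = 2\<^sup>j\<close>, interpolating
  between the two gives the same bound \<open>2\<^sup>L\<close> at every level.
\<close>

lemma sum_powr_walsh_levels:
  fixes s :: "nat \<Rightarrow> nat \<Rightarrow> real"
  assumes r: "2 < r" and g: "g = 2 powr (1 / r)" and s: "\<And>j n. \<bar>s j n\<bar> \<le> 1"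
  shows "(\<Sum>k<2 ^ L. \<bar>\<Sum>j<L. (g / 2) ^ j * (\<Sum>n<2 ^ L. walsh j n k * s j n)\<bar> powr r)
    \<le> 4 * (2 * g / (g - 1)) powr (r - 2) * (real L)\<^sup>2 * 2 ^ L"
proof -
  have g1: "1 < g" and gr: "\<And>j. (g ^ j) powr r = 2 ^ j" unfolding g using root_power_powr[OF r] by auto
  define D where "D = 4 * (2 * g / (g - 1)) powr (r - 2)"
  have D: "0 \<le> D" by (simp add: D_def)
  define y where "y j k = \<bar>(g / 2) ^ j * (\<Sum>n<2 ^ L. walsh j n k * s j n)\<bar>" for j k
  have y_le: "y j k \<le> g ^ j" if "j < L" "k < 2 ^ L" for j k
  proof -
    have N: "(2::nat) ^ L = 2 ^ j * 2 ^ (L - j)" using that by (simp add: power_add[symmetric])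
    have "\<bar>\<Sum>n<2 ^ L. walsh j n k * s j n\<bar> \<le> (\<Sum>n<2 ^ L. \<bar>walsh j n k\<bar>)"
      using s by (intro order_trans[OF sum_abs] sum_mono) (auto simp: abs_mult intro: mult_left_le)
    also have "\<dots> = 2 ^ j" unfolding N by (rule sum_abs_walsh) (use that N in simp)
    finally have "y j k \<le> (g / 2) ^ j * 2 ^ j"
      unfolding y_def abs_mult using g1 by (intro mult_mono) auto
    then show ?thesis by (simp add: power_divide)
  qed
  have energy: "(\<Sum>k<2 ^ L. (g ^ j) powr (r - 2) * (y j k)\<^sup>2) \<le> 2 ^ L" if "j < L" for j
  proof -
    have N: "(2::nat) ^ L = 2 ^ j * 2 ^ (L - j)" using that by (simp add: power_add[symmetric])
    have "(\<Sum>k<2 ^ L. (\<Sum>n<2 ^ L. walsh j n k * s j n)\<^sup>2) = 2 ^ j * (\<Sum>n<2 ^ L. (s j n)\<^sup>2)"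
      using sum_norm_walsh_transform[where j = j and M = "2 ^ (L - j)" and s = "s j"] unfolding N[symmetric] by simp
    also have "\<dots> \<le> 2 ^ j * (\<Sum>n<(2::nat) ^ L. 1)"
      using s by (intro mult_left_mono sum_mono) (auto simp: abs_square_le_1)
    finally have *: "(\<Sum>k<2 ^ L. (\<Sum>n<2 ^ L. walsh j n k * s j n)\<^sup>2) \<le> 2 ^ j * 2 ^ L" by simp
    have "(g ^ j) powr (r - 2) * ((g / 2) ^ j)\<^sup>2 * 2 ^ j = ((g ^ j) powr (r - 2) * (g ^ j) powr 2) / 2 ^ j"
      using g1 by (simp add: power_divide power2_eq_square field_simps)
    also have "\<dots> = 1" using g1 gr[of j] by (simp only: powr_add[symmetric]) simp
    finally have one: "(g ^ j) powr (r - 2) * ((g / 2) ^ j)\<^sup>2 * 2 ^ j = 1" .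
    have "(\<Sum>k<2 ^ L. (g ^ j) powr (r - 2) * (y j k)\<^sup>2)
        = (g ^ j) powr (r - 2) * ((g / 2) ^ j)\<^sup>2 * (\<Sum>k<2 ^ L. (\<Sum>n<2 ^ L. walsh j n k * s j n)\<^sup>2)"
      unfolding sum_distrib_left[of "(g ^ j) powr (r - 2) * ((g / 2) ^ j)\<^sup>2"]
      by (simp add: y_def power_mult_distrib mult.assoc)
    also have "\<dots> \<le> (g ^ j) powr (r - 2) * ((g / 2) ^ j)\<^sup>2 * (2 ^ j * 2 ^ L)"
      using * by (intro mult_left_mono) auto
    finally show ?thesis using one by (simp add: mult.assoc[symmetric])
  qed
  have "(\<Sum>k<2 ^ L. \<bar>\<Sum>j<L. (g / 2) ^ j * (\<Sum>n<2 ^ L. walsh j n k * s j n)\<bar> powr r)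
      \<le> (\<Sum>k<2 ^ L. (\<Sum>j<L. y j k) powr r)"
    unfolding y_def using r by (intro sum_mono powr_mono2 sum_abs) auto
  also have "\<dots> \<le> (\<Sum>k<2 ^ L. D * L * (\<Sum>j<L. (g ^ j) powr (r - 2) * (y j k)\<^sup>2))"
    unfolding D_def using r g1 y_le by (intro sum_mono sum_powr_le_geometric) (auto simp: y_def)
  also have "\<dots> = D * L * (\<Sum>j<L. \<Sum>k<2 ^ L. (g ^ j) powr (r - 2) * (y j k)\<^sup>2)"
    by (subst sum.swap) (simp add: sum_distrib_left)
  also have "\<dots> \<le> D * L * (\<Sum>j<L. 2 ^ L)"
    using D energy by (intro mult_left_mono sum_mono) auto
  finally show ?thesis by (simp add: D_def power2_eq_square mult_ac)
qed

lemma lp_ball_finite_support: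
  fixes v :: "nat \<Rightarrow> 'k::real_normed_field"
  assumes r: "1 \<le> r" and C: "0 \<le> C" and v: "\<And>k. N \<le> k \<Longrightarrow> v k = 0"
    and le: "(\<Sum>k<N. norm (v k) powr r) \<le> C powr r"
  shows "lp_finite (ereal r) v" "lp_norm (ereal r) v \<le> C"
proof -
  have "(\<Sum>k<K. norm (v k) powr r) \<le> C powr r" for K
  proof -
    have "(\<Sum>k<K. norm (v k) powr r) \<le> (\<Sum>k<max K N. norm (v k) powr r)"
      by (intro sum_mono2) auto
    also have "\<dots> = (\<Sum>k<N. norm (v k) powr r)"
      using v by (intro sum.mono_neutral_right) auto
    finally show ?thesis using le by simp
  qed
  then show "lp_finite (ereal r) v" "lp_norm (ereal r) v \<le> C"
    using lp_real_ball_iff[OF r C, of v] by auto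
qed

text \<open>
  The vectors \<open>x\<close> are the rows of the matrices \<open>walsh j\<close> for \<open>j < L\<close>, weighted so that the \<open>L\<close> levels are
  comparable, and the multipliers \<open>a\<close> are the same rows, normalised in \<open>\<ell>\<^sub>r\<close>. All signs cancel in the
  products, so every level adds the same constant vector and the \<open>r\<close>-th power of the norm is of order
  \<open>2\<^sup>L * L powr r\<close>, while for subset sums it is at most of order \<open>2\<^sup>L * L\<^sup>2\<close>. For \<open>r > 2\<close> and large \<open>L\<close> this
  contradicts a uniform finite inequality.
\<close>

lemma not_preserves_lp_gt_2:
  assumes r: "2 < r"
  shows "\<not> preserves_unconditional_convergence (lp (ereal r)) (lp (ereal r)) (lp (ereal r))
    (coordinatewise_mult :: (nat \<Rightarrow> 'k::{real_normed_field, banach}) \<Rightarrow> _)"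
proof
  assume pres: "preserves_unconditional_convergence (lp (ereal r)) (lp (ereal r)) (lp (ereal r))
    (coordinatewise_mult :: (nat \<Rightarrow> 'k) \<Rightarrow> _)"
  have p1: "1 \<le> ereal r" and r1: "1 \<le> r" using r by auto
  let ?lp = "lp (ereal r) :: ('k, nat \<Rightarrow> 'k) normed_structure"
  obtain d :: real where d: "0 < d" and
    small: "\<And>(F :: nat set) x a. finite F \<Longrightarrow> (\<And>n. n \<in> F \<Longrightarrow> x n \<in> carrier ?lp) \<Longrightarrow>
      (\<And>n. n \<in> F \<Longrightarrow> a n \<in> carrier ?lp) \<Longrightarrow> (\<And>n. n \<in> F \<Longrightarrow> vnorm ?lp (a n) \<le> 1) \<Longrightarrow>
      (\<And>G. G \<subseteq> F \<Longrightarrow> vnorm ?lp (sum x G) \<le> d) \<Longrightarrow>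
      vnorm ?lp (\<Sum>n\<in>F. coordinatewise_mult (a n) (x n)) < 1"
    by (rule preserves_unconditional_convergenceD[OF banach_action_coordinatewise_mult[OF p1] pres]) blast
  define g where "g = 2 powr (1 / r)"
  have g1: "1 < g" and gr: "\<And>j. (g ^ j) powr r = 2 ^ j" unfolding g_def using root_power_powr[OF r] by auto
  define D where "D = 4 * (2 * g / (g - 1)) powr (r - 2)"
  have D: "0 < D" using g1 by (simp add: D_def)
  \<comment> \<open>\<open>L\<close> is so large that \<open>D * L\<^sup>2 \<le> d powr r * L powr r\<close>\<close>
  obtain L :: nat where L: "(D / d powr r) powr (1 / (r - 2)) < L" using reals_Archimedean2 by blast
  have L0: "0 < real L" using L by (rule le_less_trans[rotated]) simp
  have DL: "D * real L powr (2 - r) \<le> d powr r"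
  proof -
    have "D / d powr r = ((D / d powr r) powr (1 / (r - 2))) powr (r - 2)"
      using D d r by (simp add: powr_powr)
    also have "\<dots> \<le> real L powr (r - 2)" using L r by (intro powr_mono2) auto
    finally have "D \<le> real L powr (r - 2) * d powr r" using d by (simp add: field_simps)
    then have "D * real L powr (2 - r) \<le> real L powr (r - 2) * d powr r * real L powr (2 - r)"
      by (intro mult_right_mono) auto
    also have "\<dots> = d powr r * (real L powr (r - 2) * real L powr (2 - r))" by simp
    also have "real L powr (r - 2) * real L powr (2 - r) = 1" using L0 by (simp only: powr_add[symmetric]) simp
    finally show ?thesis by simp
  qed
  define N :: nat where "N = 2 ^ L"
  have N: "real N = 2 ^ L" "0 < real N" by (simp_all add: N_def)
  \<comment> \<open>normalises the norm of the sum of the products to 1\<close>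
  define t where "t = 1 / (L * real N powr (1 / r))"
  have t: "0 < t" using L0 N by (simp add: t_def)
  have tr: "t powr r * (real L powr r * N) = 1"
    using L0 N(2) r by (simp add: t_def powr_divide powr_mult powr_powr)
  define w where "w j n k = (if k < N then walsh j n k else 0)" for j n k
  define x :: "nat \<Rightarrow> nat \<Rightarrow> 'k" where
    "x m k = (case prod_decode m of (j, n) \<Rightarrow> of_real (t * (g / 2) ^ j * w j n k))" for m k
  define a :: "nat \<Rightarrow> nat \<Rightarrow> 'k" where
    "a m k = (case prod_decode m of (j, n) \<Rightarrow> of_real ((1 / g) ^ j * w j n k))" for m k
  define F where "F = prod_encode ` ({..<L} \<times> {..<N})"
  have inj: "inj_on prod_encode S" for S using inj_prod_encode .
  have over_F: "(\<Sum>m\<in>F. h m) = (\<Sum>j<L. \<Sum>n<N. h (prod_encode (j, n)))" for h :: "nat \<Rightarrow> 'c::comm_monoid_add"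
    unfolding F_def sum.reindex[OF inj] by (simp add: sum.cartesian_product)
  have x_ball: "lp_finite (ereal r) (sum x G) \<and> lp_norm (ereal r) (sum x G) \<le> d" if G: "G \<subseteq> F" for G
  proof -
    define s where "s j n = (if prod_encode (j, n) \<in> G then 1 else 0 :: real)" for j n
    have val: "sum x G k = of_real (t * (\<Sum>j<L. (g / 2) ^ j * (\<Sum>n<N. walsh j n k * s j n)))" if "k < N" for k
    proof -
      have "sum x G k = (\<Sum>m\<in>F. if m \<in> G then x m k else 0)"
        unfolding sum_fun_apply using G by (intro sum.mono_neutral_cong_left) (auto simp: F_def)
      also have "\<dots> = (\<Sum>j<L. \<Sum>n<N. of_real (t * ((g / 2) ^ j * (walsh j n k * s j n))))"
        unfolding over_F using that by (intro sum.cong) (auto simp: x_def w_def s_def)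
      finally show ?thesis by (simp add: sum_distrib_left)
    qed
    have zero: "sum x G k = 0" if "N \<le> k" for k
      unfolding sum_fun_apply using that by (intro sum.neutral) (auto simp: x_def w_def split: prod.splits)
    have "norm (sum x G k) = t * \<bar>\<Sum>j<L. (g / 2) ^ j * (\<Sum>n<N. walsh j n k * s j n)\<bar>" if "k < N" for k
      unfolding val[OF that] norm_of_real abs_mult using t by simp
    then have "(\<Sum>k<N. norm (sum x G k) powr r)
        = t powr r * (\<Sum>k<N. \<bar>\<Sum>j<L. (g / 2) ^ j * (\<Sum>n<N. walsh j n k * s j n)\<bar> powr r)"
      by (simp add: powr_mult sum_distrib_left[of "t powr r"])
    also have "\<dots> \<le> t powr r * (D * (real L)\<^sup>2 * N)"
      unfolding D_def N(1) unfolding N_def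
      by (intro mult_left_mono sum_powr_walsh_levels r g_def) (auto simp: s_def)
    also have "\<dots> = D * real L powr (2 - r) * (t powr r * (real L powr r * N))"
      using L0 by (simp add: powr_diff)
    also have "\<dots> \<le> d powr r" using DL tr by simp
    finally show ?thesis using lp_ball_finite_support[OF r1 _ zero, of d] d by auto
  qed
  have a_ball: "lp_finite (ereal r) (a m) \<and> lp_norm (ereal r) (a m) \<le> 1" if mF: "m \<in> F" for m
  proof -
    obtain j n where m: "m = prod_encode (j, n)" "j < L" "n < N" using mF by (auto simp: F_def)
    have split: "N = 2 ^ j * 2 ^ (L - j)" using m by (simp add: N_def power_add[symmetric])
    have "norm (a m k) powr r = (1 / 2 ^ j) * \<bar>walsh j k n\<bar>" if "k < N" for k
    proof -
      have "\<bar>walsh j k n\<bar> powr r = \<bar>walsh j k n\<bar>" using walsh_cases[of j k n] by auto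
      moreover have "a m k = of_real ((1 / g) ^ j * walsh j k n)"
        using that by (simp add: a_def m w_def walsh_commute[of j n])
      then have "norm (a m k) = (1 / g) ^ j * \<bar>walsh j k n\<bar>"
        using g1 by (simp only: norm_of_real abs_mult) simp
      ultimately show ?thesis
        using gr[of j] by (simp add: powr_mult powr_divide power_divide)
    qed
    then have "(\<Sum>k<N. norm (a m k) powr r) = (1 / 2 ^ j) * (\<Sum>k<N. \<bar>walsh j k n\<bar>)"
      unfolding sum_distrib_left by simp
    also have "(\<Sum>k<N. \<bar>walsh j k n\<bar>) = 2 ^ j"
      unfolding split by (rule sum_abs_walsh) (use m split in simp)
    finally have "(\<Sum>k<N. norm (a m k) powr r) \<le> 1 powr r" by simp
    moreover have "a m k = 0" if "N \<le> k" for k using that by (simp add: a_def m w_def)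
    ultimately show ?thesis using lp_ball_finite_support[OF r1, of 1 N "a m"] by auto
  qed
  define z where "z = (\<Sum>m\<in>F. coordinatewise_mult (a m) (x m))"
  have "vnorm ?lp z < 1"
    unfolding z_def
  proof (rule small)
    show "finite F" by (simp add: F_def)
    show "x n \<in> carrier ?lp" if "n \<in> F" for n using x_ball[of "{n}"] that by (simp add: lp_def)
    show "a n \<in> carrier ?lp" "vnorm ?lp (a n) \<le> 1" if "n \<in> F" for n using a_ball[OF that] by (auto simp: lp_def)
    show "vnorm ?lp (sum x G) \<le> d" if "G \<subseteq> F" for G using x_ball[OF that] by (simp add: lp_def)
  qed
  then have lt: "lp_norm (ereal r) z < 1" by (simp add: lp_def)
  have z: "z k = of_real (t * L)" if k: "k < N" for k
  proof -
    have "(\<Sum>n<N. (1 / g) ^ j * w j n k * (t * (g / 2) ^ j * w j n k)) = t" if j: "j < L" for j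
    proof -
      have split: "N = 2 ^ j * 2 ^ (L - j)" using j by (simp add: N_def power_add[symmetric])
      have "(\<Sum>n<N. (1 / g) ^ j * w j n k * (t * (g / 2) ^ j * w j n k)) = (\<Sum>n<N. t / 2 ^ j * \<bar>walsh j n k\<bar>)"
      proof (intro sum.cong refl)
        fix n
        have "walsh j n k * walsh j n k = \<bar>walsh j n k\<bar>" using walsh_cases[of j n k] by auto
        then show "(1 / g) ^ j * w j n k * (t * (g / 2) ^ j * w j n k) = t / 2 ^ j * \<bar>walsh j n k\<bar>"
          using k g1 by (simp add: w_def power_divide)
      qed
      also have "\<dots> = t / 2 ^ j * 2 ^ j"
        unfolding sum_distrib_left[symmetric] unfolding split
        by (subst sum_abs_walsh) (use k split in simp_all)
      finally show ?thesis by simp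
    qed
    then have sum: "(\<Sum>j<L. \<Sum>n<N. (1 / g) ^ j * w j n k * (t * (g / 2) ^ j * w j n k)) = t * L" by simp
    have "z k = (\<Sum>j<L. \<Sum>n<N. of_real ((1 / g) ^ j * w j n k * (t * (g / 2) ^ j * w j n k)))"
      unfolding z_def sum_fun_apply over_F
      by (intro sum.cong refl) (simp add: coordinatewise_mult_def a_def x_def)
    also have "\<dots> = of_real (t * L)" unfolding sum[symmetric] of_real_sum ..
    finally show ?thesis .
  qed
  have "norm (z k) = t * L" if "k < N" for k
    unfolding z[OF that] norm_of_real using t by simp
  then have sum_z: "(\<Sum>k<N. norm (z k) powr r) = 1"
    using tr by (simp add: powr_mult mult_ac)
  have "lp_finite (ereal r) z"
  proof (rule lp_ball_finite_support(1)[OF r1, of 1 N])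
    show "z k = 0" if "N \<le> k" for k
      unfolding z_def sum_fun_apply using that
      by (intro sum.neutral) (auto simp: coordinatewise_mult_def x_def w_def split: prod.splits)
    show "(\<Sum>k<N. norm (z k) powr r) \<le> 1 powr r"
      using sum_z by simp
  qed simp
  then have "(\<Sum>k<N. norm (z k) powr r) \<le> lp_norm (ereal r) z powr r"
    using lp_real_ball_iff[OF r1 lp_norm_nonneg, of "ereal r" z z] by blast
  also have "\<dots> < 1 powr r"
    using lt r lp_norm_nonneg[OF \<open>lp_finite (ereal r) z\<close>] by (intro powr_less_mono2) auto
  finally show False using sum_z by simp
qed

section \<open>The characterisation\<close>

lemma preserves_lp_iff:
  assumes "1 \<le> p"
  shows "preserves_unconditional_convergence (lp p) (lp p) (lp p)
      (coordinatewise_mult :: (nat \<Rightarrow> 'k::{real_normed_field, euclidean_space}) \<Rightarrow> _)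
    \<longleftrightarrow> p \<in> {1..2} \<union> {\<infinity>}"
  using assms
proof (cases rule: one_le_ereal_cases)
  case infinity
  then show ?thesis using preserves_lp_infinity by simp
next
  case (real r)
  then show ?thesis
    using preserves_lp_le_2[of p] not_preserves_lp_gt_2[of r] assms by (cases "r \<le> 2") auto
qed

theorem corollary1p3:
  fixes p :: ereal
  assumes "1 \<le> p"
  shows "(preserves_unconditional_convergence (lp p) (lp p) (lp p)
            (coordinatewise_mult :: (nat \<Rightarrow> real) \<Rightarrow> (nat \<Rightarrow> real) \<Rightarrow> nat \<Rightarrow> real)
          \<longleftrightarrow> p \<in> {1..2} \<union> {\<infinity>}) \<and>
         (preserves_unconditional_convergence (lp p) (lp p) (lp p)
            (coordinatewise_mult :: (nat \<Rightarrow> complex) \<Rightarrow> (nat \<Rightarrow> complex) \<Rightarrow> nat \<Rightarrow> complex)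
          \<longleftrightarrow> p \<in> {1..2} \<union> {\<infinity>})"
  by (intro conjI) (rule preserves_lp_iff[OF assms])+

end
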